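(* Let $(f,g),(h,k)\in\mathscr{C}_3(I)$, let $m\in\mathscr{C}_3(I^d\times T)$ be a measurable family of means, and let $\mu$ be a probability measure on the measurable space $(T,\mathscr{A})$. Assume that there exists a dense subset $D\subseteq I$ such that, for all $x\in D$, $$\mu\Big(\big\{t\in T\mid \partial_1^*m(x^{(d)},t)=\cdots=\partial_d^*m(x^{(d)},t)=0\big\}\Big)<1$$ and there exist $i,j,l\in\{1,\dots,d\}$ such that $$\big\langle\partial_i^*m\,\partial_j^*m\,\partial_l^*m\big\rangle_\mu\big(x^{(d)}\big)\neq0.$$ Then the following assertions are equivalent: (i) For all $\boldsymbol{x}\in I^d$, $M_{f,g,m;\mu}(\boldsymbol{x})=M_{h,k,m;\mu}(\boldsymbol{x})$; (ii) There exists an open set $U\subseteq I^d$ containing the subdiagonal $\{x^{(d)}\mid x\in D\}$ such that $M_{f,g,m;\mu}(\boldsymbol{x})=M_{h,k,m;\mu}(\boldsymbol{x})$ for all $\boldsymbol{x}\in U$; (iii) $\Phi_{f,g}=\Phi_{h,k}$ and $\Psi_{f,g}=\Psi_{h,k}$ on $I$; (iv) The pairs $(f,g)$ and $(h,k)$ are equivalent.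
   Context: $I$ is a nonempty open real interval, $d$ is a positive integer, $(T,\mathscr{A})$ is a measurable space. A function $M:I^d\to I$ is a $d$-variable mean on $I$ if $\min(x_1,\dots,x_d)\le M(\boldsymbol{x})\le\max(x_1,\dots,x_d)$ for all $\boldsymbol{x}=(x_1,\dots,x_d)\in I^d$. A measurable family of $d$-variable means is a map $m:I^d\times T\to I$ such that $m(\cdot,t)$ is a $d$-variable mean on $I$ for each $t\in T$ and $m(\boldsymbol{x},\cdot)$ is measurable for each $\boldsymbol{x}\in I^d$. For $f,g:I\to\mathbb{R}$ put $\mathscr{D}_{f,g}(x,y):=f(x)g(y)-f(y)g(x)$. A pair $(f,g)$ of continuous functions is a Chebyshev system on $I$ if $\mathscr{D}_{f,g}(x,y)\ne0$ for all distinct $x,y\in I$. For $n\ge1$, $\mathscr{C}_n(I)$ is the class of pairs $(f,g)$ of $n$-times continuously differentiable real functions on $I$ that form a Chebyshev system on $I$ and whose Wronskian $f'g-fg'$ does not vanish on $I$. For $(f,g)\in\mathscr{C}_2(I)$, $$\Phi_{f,g}:=\frac{f''g-fg''}{f'g-fg'},\qquad \Psi_{f,g}:=-\frac{f''g'-f'g''}{f'g-fg'}.$$ Pairs $(f,g)$ and $(h,k)$ are equivalent if there are $\alpha,\beta,\gamma,\delta\in\mathbb{R}$ with $\alpha\delta-\beta\gamma\ne0$, $f=\alpha h+\beta k$ and $g=\gamma h+\delta k$. For a Chebyshev system $(f,g)$ on $I$, a measurable family $m$ and a probability measure $\mu$ on $(T,\mathscr{A})$, $M_{f,g,m;\mu}(\boldsymbol{x})$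 is the unique $y\in I$ with $\int_T\mathscr{D}_{f,g}(m(\boldsymbol{x},t),y)\,d\mu(t)=0$ (existence and uniqueness of $y$ are known). If $g>0$ and $f/g$ is strictly monotone, then $M_{f,g,m;\mu}(\boldsymbol{x})=\left(\frac fg\right)^{-1}\left(\frac{\int_T f(m(\boldsymbol{x},t))\,d\mu(t)}{\int_T g(m(\boldsymbol{x},t))\,d\mu(t)}\right)$. A function $\varphi:I^d\times T\to\mathbb{R}$ is of $L^q$-type ($q\ge1$) at $\boldsymbol{p}\in I^d$ if $\varphi(\boldsymbol{p},\cdot)$ is measurable and there exist $\delta>0$ and a measurable $a:T\to\mathbb{R}$ with $|a|^q$ $\mu$-integrable such that $|\varphi(\boldsymbol{x},t)|\le a(t)$ for all $t\in T$ and all $\boldsymbol{x}\in I^d$ with $|\boldsymbol{x}-\boldsymbol{p}|\le\delta$. $\mathscr{C}_1(I^d\times T)$ is the class of measurable families $m$ of $d$-variable means such that each $m(\cdot,t)$ is continuously partially differentiable on $I^d$ and each $\partial_i m$ is of $L^1$-type at every $\boldsymbol{p}\in I^d$. $\mathscr{C}_2(I^d\times T)$ consists of those $m\in\mathscr{C}_1(I^d\times T)$ such that each $m(\cdot,t)$ is twice continuously partially differentiable and, at every $\boldsymbol{p}$ and for all $i,j$, $\partial_i m$ is of $L^2$-type and $\partial_i\partial_j m$ of $L^1$-type. $\mathscr{C}_3(I^d\times T)$ consists of those $m\in\mathscr{C}_2(I^d\times T)$ such that each $m(\cdot,t)$ is three times continuously partially differentiable and, at every $\boldsymbol{p}$ and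 for all $i,j,l$, $\partial_i m$ is of $L^3$-type, $\partial_i\partial_j m$ of $L^{3/2}$-type and $\partial_i\partial_j\partial_l m$ of $L^1$-type. Partial derivatives are with respect to the variables in $I^d$. Notation: $\langle\varphi\rangle_\mu(\boldsymbol{x}):=\int_T\varphi(\boldsymbol{x},t)\,d\mu(t)$; $\partial_r^*m(\boldsymbol{x},t):=\partial_r m(\boldsymbol{x},t)-\langle\partial_r m\rangle_\mu(\boldsymbol{x})$; $x^{(d)}:=(x,\dots,x)\in I^d$ for $x\in I$. *)

theory Defs
  imports "HOL-Probability.Probability"
begin

text \<open>The dimension \<open>d \<ge> 1\<close> is the cardinality of the finite index type \<open>'d\<close>.\<close>

definition cube :: "real set \<Rightarrow> (real ^ 'd) set" where
  "cube I = {x. \<forall>i. x $ i \<in> I}"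

definition diag :: "real \<Rightarrow> real ^ 'd" where
  "diag x = (\<chi> i. x)"

definition mean_on :: "real set \<Rightarrow> (real ^ 'd::finite \<Rightarrow> real) \<Rightarrow> bool" where
  "mean_on I M \<longleftrightarrow>
     (\<forall>x\<in>cube I. M x \<in> I \<and> Min (range (\<lambda>i. x $ i)) \<le> M x \<and> M x \<le> Max (range (\<lambda>i. x $ i)))"

text \<open>The measurable space \<open>(T, \<A>)\<close> is \<open>(space \<mu>, sets \<mu>)\<close>.\<close>

definition measurable_family :: "real set \<Rightarrow> 't measure \<Rightarrow> (real ^ 'd::finite \<Rightarrow> 't \<Rightarrow> real) \<Rightarrow> bool" where
  "measurable_family I \<mu> m \<longleftrightarrow>
     (\<forall>t\<in>space \<mu>. mean_on I (\<lambda>x. m x t)) \<and> (\<forall>x\<in>cube I. m x \<in> borel_measurable \<mu>)"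

definition DD :: "(real \<Rightarrow> real) \<Rightarrow> (real \<Rightarrow> real) \<Rightarrow> real \<Rightarrow> real \<Rightarrow> real" where
  "DD f g x y = f x * g y - f y * g x"

definition chebyshev_system :: "real set \<Rightarrow> (real \<Rightarrow> real) \<Rightarrow> (real \<Rightarrow> real) \<Rightarrow> bool" where
  "chebyshev_system I f g \<longleftrightarrow>
     continuous_on I f \<and> continuous_on I g \<and> (\<forall>x\<in>I. \<forall>y\<in>I. x \<noteq> y \<longrightarrow> DD f g x y \<noteq> 0)"

text \<open>Functions on \<open>I\<close> are represented by total functions. All derivatives are two-sided; since they
  are only taken at points of the open sets \<open>I\<close> and \<open>cube I\<close>, they do not depend on the values outside.\<close>

definition cont_differentiable :: "nat \<Rightarrow> real set \<Rightarrow> (real \<Rightarrow> real) \<Rightarrow> bool" where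
  "cont_differentiable n I f \<longleftrightarrow>
     (\<forall>j<n. \<forall>x\<in>I. (deriv ^^ j) f field_differentiable (at x)) \<and> continuous_on I ((deriv ^^ n) f)"

definition wronskian :: "(real \<Rightarrow> real) \<Rightarrow> (real \<Rightarrow> real) \<Rightarrow> real \<Rightarrow> real" where
  "wronskian f g x = deriv f x * g x - f x * deriv g x"

definition chebyshev_class :: "nat \<Rightarrow> real set \<Rightarrow> ((real \<Rightarrow> real) \<times> (real \<Rightarrow> real)) set" where
  "chebyshev_class n I =
     {(f, g). cont_differentiable n I f \<and> cont_differentiable n I g \<and>
              chebyshev_system I f g \<and> (\<forall>x\<in>I. wronskian f g x \<noteq> 0)}"

definition Phi :: "(real \<Rightarrow> real) \<Rightarrow> (real \<Rightarrow> real) \<Rightarrow> real \<Rightarrow> real" where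
  "Phi f g x = (deriv (deriv f) x * g x - f x * deriv (deriv g) x) / wronskian f g x"

definition Psi :: "(real \<Rightarrow> real) \<Rightarrow> (real \<Rightarrow> real) \<Rightarrow> real \<Rightarrow> real" where
  "Psi f g x = - ((deriv (deriv f) x * deriv g x - deriv f x * deriv (deriv g) x) / wronskian f g x)"

definition equivalent_pairs ::
    "real set \<Rightarrow> (real \<Rightarrow> real) \<times> (real \<Rightarrow> real) \<Rightarrow> (real \<Rightarrow> real) \<times> (real \<Rightarrow> real) \<Rightarrow> bool" where
  "equivalent_pairs I = (\<lambda>(f, g) (h, k). \<exists>\<alpha> \<beta> \<gamma> \<delta>. \<alpha> * \<delta> - \<beta> * \<gamma> \<noteq> 0 \<and>
     (\<forall>x\<in>I. f x = \<alpha> * h x + \<beta> * k x \<and> g x = \<gamma> * h x + \<delta> * k x))"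

text \<open>The integrand is bounded and measurable for every \<open>x\<close> in the cube, and the solution exists and
  is unique whenever \<open>(f, g)\<close> is a Chebyshev system on the open interval \<open>I\<close>, \<open>m\<close> is a measurable
  family of means and \<open>\<mu>\<close> is a probability measure.\<close>

definition gen_mean ::
    "real set \<Rightarrow> (real \<Rightarrow> real) \<Rightarrow> (real \<Rightarrow> real) \<Rightarrow> (real ^ 'd \<Rightarrow> 't \<Rightarrow> real) \<Rightarrow> 't measure \<Rightarrow>
     real ^ 'd \<Rightarrow> real" where
  "gen_mean I f g m \<mu> x = (THE y. y \<in> I \<and> (\<integral>t. DD f g (m x t) y \<partial>\<mu>) = 0)"

definition pderiv_ax :: "'d \<Rightarrow> (real ^ 'd::finite \<Rightarrow> real) \<Rightarrow> real ^ 'd \<Rightarrow> real" where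
  "pderiv_ax i F x = deriv (\<lambda>s. F (x + s *\<^sub>R axis i 1)) 0"

definition pdifferentiable :: "'d \<Rightarrow> (real ^ 'd::finite \<Rightarrow> real) \<Rightarrow> real ^ 'd \<Rightarrow> bool" where
  "pdifferentiable i F x \<longleftrightarrow> (\<lambda>s. F (x + s *\<^sub>R axis i 1)) field_differentiable (at 0)"

fun cont_pdifferentiable :: "nat \<Rightarrow> (real ^ 'd::finite) set \<Rightarrow> (real ^ 'd \<Rightarrow> real) \<Rightarrow> bool" where
  "cont_pdifferentiable 0 S F \<longleftrightarrow> continuous_on S F"
| "cont_pdifferentiable (Suc n) S F \<longleftrightarrow>
     (\<forall>i. (\<forall>x\<in>S. pdifferentiable i F x) \<and> cont_pdifferentiable n S (pderiv_ax i F))"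

definition pd :: "'d \<Rightarrow> (real ^ 'd::finite \<Rightarrow> 't \<Rightarrow> real) \<Rightarrow> real ^ 'd \<Rightarrow> 't \<Rightarrow> real" where
  "pd i m x t = pderiv_ax i (\<lambda>y. m y t) x"

definition L_type ::
    "real \<Rightarrow> real set \<Rightarrow> 't measure \<Rightarrow> (real ^ 'd::finite \<Rightarrow> 't \<Rightarrow> real) \<Rightarrow> real ^ 'd \<Rightarrow> bool" where
  "L_type q I \<mu> \<phi> p \<longleftrightarrow> \<phi> p \<in> borel_measurable \<mu> \<and>
     (\<exists>\<delta>>0. \<exists>a. a \<in> borel_measurable \<mu> \<and> integrable \<mu> (\<lambda>t. \<bar>a t\<bar> powr q) \<and>
        (\<forall>t\<in>space \<mu>. \<forall>x\<in>cube I. norm (x - p) \<le> \<delta> \<longrightarrow> \<bar>\<phi> x t\<bar> \<le> a t))"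

definition family_C1 :: "real set \<Rightarrow> 't measure \<Rightarrow> (real ^ 'd::finite \<Rightarrow> 't \<Rightarrow> real) set" where
  "family_C1 I \<mu> = {m. measurable_family I \<mu> m \<and>
     (\<forall>t\<in>space \<mu>. cont_pdifferentiable 1 (cube I) (\<lambda>x. m x t)) \<and>
     (\<forall>p\<in>cube I. \<forall>i. L_type 1 I \<mu> (pd i m) p)}"

definition family_C2 :: "real set \<Rightarrow> 't measure \<Rightarrow> (real ^ 'd::finite \<Rightarrow> 't \<Rightarrow> real) set" where
  "family_C2 I \<mu> = {m \<in> family_C1 I \<mu>.
     (\<forall>t\<in>space \<mu>. cont_pdifferentiable 2 (cube I) (\<lambda>x. m x t)) \<and>
     (\<forall>p\<in>cube I. \<forall>i j. L_type 2 I \<mu> (pd i m) p \<and> L_type 1 I \<mu> (pd i (pd j m)) p)}"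

definition family_C3 :: "real set \<Rightarrow> 't measure \<Rightarrow> (real ^ 'd::finite \<Rightarrow> 't \<Rightarrow> real) set" where
  "family_C3 I \<mu> = {m \<in> family_C2 I \<mu>.
     (\<forall>t\<in>space \<mu>. cont_pdifferentiable 3 (cube I) (\<lambda>x. m x t)) \<and>
     (\<forall>p\<in>cube I. \<forall>i j l. L_type 3 I \<mu> (pd i m) p \<and> L_type (3/2) I \<mu> (pd i (pd j m)) p \<and>
        L_type 1 I \<mu> (pd i (pd j (pd l m))) p)}"

definition avg :: "'t measure \<Rightarrow> (real ^ 'd \<Rightarrow> 't \<Rightarrow> real) \<Rightarrow> real ^ 'd \<Rightarrow> real" where
  "avg \<mu> \<phi> x = (\<integral>t. \<phi> x t \<partial>\<mu>)"

definition pd_star ::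
    "'t measure \<Rightarrow> 'd \<Rightarrow> (real ^ 'd::finite \<Rightarrow> 't \<Rightarrow> real) \<Rightarrow> real ^ 'd \<Rightarrow> 't \<Rightarrow> real" where
  "pd_star \<mu> r m x t = pd r m x t - avg \<mu> (pd r m) x"

end

theory Submission
  imports Defs
begin

text \<open>
  Write \<open>W\<close> for the Wronskian of a pair. The two functions of a pair are solutions of
  \<open>Y'' = \<Phi> Y' + \<Psi> Y\<close>, so equality of the functions \<open>\<Phi>\<close> and \<open>\<Psi>\<close> means that the two pairs are fundamental
  systems of the same equation, that is, equivalent (\<open>Phi_Psi_eq_imp_equivalent_pairs\<close> and
  \<open>equivalent_pairs_imp_Phi_Psi_eq\<close>). Equivalent pairs have proportional kernels \<open>DD\<close> and hence the same
  means.

  The substance is that equality of the means near the points \<open>diag x\<close> with \<open>x \<in> D\<close> determines \<open>\<Phi>\<close> and \<open>\<Psi>\<close>.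
  The normalized kernel expands as
  \<open>DD f g u y / W(y) = (u - y) + \<Phi>(y) (u - y)^2 / 2 + (\<Phi>^2 + \<Phi>' + \<Psi>)(y) (u - y)^3 / 6 + o(\<bar>u - y\<bar>^3)\<close>.
  If both pairs have the same mean \<open>y\<close> at a point, then the integral over \<open>t\<close> of the difference of the two kernels, taken at
  \<open>u = m(\<cdot>, t)\<close> and this \<open>y\<close>, is zero, and in this difference the linear terms cancel. Now let the point be \<open>diag x + s v\<close> with
  \<open>s \<rightarrow> 0\<close>. Then \<open>(u - y) / s\<close> tends to \<open>\<Sum>r. v_r \<partial>_r^* m\<close>: the linear term of a single kernel shows that the derivative
  of \<open>y\<close> in the direction \<open>v\<close> is the mean value of the derivative of \<open>u\<close>. Consequently the leading coefficient of the
  difference of the kernels, times the moment \<open>\<integral> (\<Sum>r. v_r \<partial>_r^* m)^n\<close>, is zero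
  (\<open>equal_means_imp_moment_vanishes\<close>).

  With \<open>n = 2\<close>, some second moment is positive by the nondegeneracy assumption, which gives equality of the \<open>\<Phi>\<close> on
  \<open>D\<close> and, by continuity, on \<open>I\<close>. Then the leading order is \<open>n = 3\<close> with a coefficient that is a multiple of
  the difference of the \<open>\<Psi>\<close>, and by polarization the assumption on the mixed third moments provides
  a direction \<open>v\<close> whose third moment is nonzero.
\<close>

section \<open>Directional derivatives from continuous partial derivatives\<close>

lemma has_real_derivative_along_axis:
  fixes F :: "real ^ 'd::finite \<Rightarrow> real"
  assumes "pdifferentiable i F (x + (r * c) *\<^sub>R axis i 1)"
  shows "((\<lambda>r. F (x + (r * c) *\<^sub>R axis i 1)) has_real_derivative
           c * pderiv_ax i F (x + (r * c) *\<^sub>R axis i 1)) (at r)"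
proof -
  let ?z = "x + (r * c) *\<^sub>R axis i 1"
  have *: "((\<lambda>s. F (?z + s *\<^sub>R axis i 1)) has_real_derivative pderiv_ax i F ?z) (at ((r - r) * c))"
    using assms unfolding pdifferentiable_def pderiv_ax_def
    by (simp add: field_differentiable_derivI)
  have "((\<lambda>r'. F (?z + ((r' - r) * c) *\<^sub>R axis i 1)) has_real_derivative
           pderiv_ax i F ?z * c) (at r)"
    by (rule DERIV_chain2[where g = "\<lambda>r'. (r' - r) * c", OF *]) (auto intro!: derivative_eq_intros)
  also have "(\<lambda>r'. F (?z + ((r' - r) * c) *\<^sub>R axis i 1)) = (\<lambda>r'. F (x + (r' * c) *\<^sub>R axis i 1))"
    by (intro ext arg_cong[where f = F]) (simp add: add.assoc left_diff_distrib flip: scaleR_add_left)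
  finally show ?thesis by (simp add: mult.commute)
qed

text \<open>The vector \<open>v\<close> is built up one coordinate at a time. Adding the coordinate \<open>i\<close> changes the function by an
  increment along the \<open>i\<close>-th axis, which the mean value theorem turns into \<open>s * v $ i\<close> times a value
  of \<open>pderiv_ax i F\<close> at a point near \<open>z\<close>; continuity of that partial derivative gives the limit.\<close>

lemma has_real_derivative_directional:
  fixes F :: "real ^ 'd::finite \<Rightarrow> real" and v :: "real ^ 'd"
  assumes "open S" "z \<in> S" "cont_pdifferentiable 1 S F"
  shows "((\<lambda>s. F (z + s *\<^sub>R v)) has_real_derivative (\<Sum>i\<in>UNIV. v $ i * pderiv_ax i F z)) (at 0)"
proof -
  have pd: "\<And>i x. x \<in> S \<Longrightarrow> pdifferentiable i F x"
    and cont: "\<And>i. continuous_on S (pderiv_ax i F)"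
    using assms(3) by (auto simp: One_nat_def)
  have main: "((\<lambda>s. F (z + s *\<^sub>R (\<Sum>i\<in>J. (v $ i) *\<^sub>R axis i 1))) has_real_derivative
          (\<Sum>i\<in>J. v $ i * pderiv_ax i F z)) (at 0)" if "finite J" for J :: "'d set"
    using that
  proof (induction J)
    case empty
    show ?case by simp
  next
    case (insert i J)
    define w where "w = (\<Sum>i\<in>J. (v $ i) *\<^sub>R axis i (1::real))"
    let ?c = "v $ i"
    \<comment> \<open>The factors \<open>1\<close> and \<open>0\<close> are the end points of the unit interval on which the
      mean value theorem is applied, with the parameter \<open>r\<close> below.\<close>
    define B where "B s = F (z + s *\<^sub>R w + (1 * (s * ?c)) *\<^sub>R axis i 1) - F (z + s *\<^sub>R w + (0 * (s * ?c)) *\<^sub>R axis i 1)" for s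
    have "((\<lambda>s. (B s - B 0) / (s - 0)) \<longlongrightarrow> ?c * pderiv_ax i F z) (at 0)"
      unfolding LIM_def
    proof (intro allI impI)
      fix e :: real assume "e > 0"
      define e' where "e' = e / (\<bar>?c\<bar> + 1)"
      have "e' > 0" using \<open>e > 0\<close> by (simp add: e'_def)
      have "isCont (pderiv_ax i F) z"
        using cont[of i] assms(1,2) by (simp add: continuous_on_eq_continuous_at)
      then obtain d1 where d1: "d1 > 0" "\<And>y. dist y z < d1 \<Longrightarrow> dist (pderiv_ax i F y) (pderiv_ax i F z) < e'"
        using \<open>e' > 0\<close> unfolding continuous_at_eps_delta by blast
      obtain d2 where d2: "d2 > 0" "\<And>y. dist y z < d2 \<Longrightarrow> y \<in> S"
        using assms(1,2) unfolding open_dist by blast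
      define d where "d = min d1 d2 / (norm w + \<bar>?c\<bar> + 1)"
      have pos: "norm w + \<bar>?c\<bar> + 1 > 0" by (simp add: add_nonneg_pos)
      have "d > 0" using d1(1) d2(1) pos by (simp add: d_def)
      moreover have "dist ((B s - B 0) / (s - 0)) (?c * pderiv_ax i F z) < e"
        if s: "s \<noteq> 0" "dist s 0 < d" for s
      proof -
        have near: "dist (z + s *\<^sub>R w + (r * (s * ?c)) *\<^sub>R axis i 1) z < min d1 d2"
          if r: "0 \<le> r" "r \<le> 1" for r
        proof -
          have "dist (z + s *\<^sub>R w + (r * (s * ?c)) *\<^sub>R axis i 1) z = norm (s *\<^sub>R w + (r * (s * ?c)) *\<^sub>R axis i 1)"
            by (simp add: dist_norm)
          also have "\<dots> \<le> norm (s *\<^sub>R w) + norm ((r * (s * ?c)) *\<^sub>R axis i (1::real))"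
            by (rule norm_triangle_ineq)
          also have "norm ((r * (s * ?c)) *\<^sub>R axis i (1::real)) = r * \<bar>s * ?c\<bar>"
            using r by (simp add: norm_axis_1 abs_mult)
          also have "norm (s *\<^sub>R w) + r * \<bar>s * ?c\<bar> \<le> norm (s *\<^sub>R w) + 1 * \<bar>s * ?c\<bar>"
            using r by (intro add_left_mono mult_right_mono) auto
          also have "\<dots> \<le> \<bar>s\<bar> * (norm w + \<bar>?c\<bar> + 1)"
            by (simp add: abs_mult algebra_simps)
          also have "\<dots> < d * (norm w + \<bar>?c\<bar> + 1)"
            using s pos by (intro mult_strict_right_mono) (auto simp: dist_real_def)
          also have "\<dots> = min d1 d2" using pos by (simp add: d_def)
          finally show ?thesis .
        qed
        have "\<exists>r>0. r < 1 \<and> B s = (1 - 0) * (s * ?c * pderiv_ax i F (z + s *\<^sub>R w + (r * (s * ?c)) *\<^sub>R axis i 1))"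
          unfolding B_def
        proof (rule MVT2)
          show "((\<lambda>r. F (z + s *\<^sub>R w + (r * (s * ?c)) *\<^sub>R axis i 1)) has_real_derivative
            s * ?c * pderiv_ax i F (z + s *\<^sub>R w + (r * (s * ?c)) *\<^sub>R axis i 1)) (at r)"
            if "0 \<le> r" "r \<le> 1" for r
            using near[OF that] by (intro has_real_derivative_along_axis pd d2) auto
        qed simp
        then obtain r where r: "0 < r" "r < 1"
          and Bs: "B s = s * ?c * pderiv_ax i F (z + s *\<^sub>R w + (r * (s * ?c)) *\<^sub>R axis i 1)" (is "_ = _ * ?p")
          by auto
        have "(B s - B 0) / (s - 0) - ?c * pderiv_ax i F z = ?c * (?p - pderiv_ax i F z)"
          using s(1) by (simp add: Bs algebra_simps B_def[of 0])
        then have "dist ((B s - B 0) / (s - 0)) (?c * pderiv_ax i F z) = \<bar>?c\<bar> * dist ?p (pderiv_ax i F z)"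
          by (simp add: dist_real_def abs_mult)
        also have "\<dots> \<le> \<bar>?c\<bar> * e'"
          using d1(2)[of "z + s *\<^sub>R w + (r * (s * ?c)) *\<^sub>R axis i 1"] near[of r] r
          by (intro mult_left_mono) auto
        also have "\<dots> < (\<bar>?c\<bar> + 1) * e'" using \<open>e' > 0\<close> by (simp add: algebra_simps)
        also have "\<dots> = e" by (simp add: e'_def)
        finally show ?thesis .
      qed
      ultimately show "\<exists>d>0. \<forall>s. s \<noteq> 0 \<and> dist s 0 < d \<longrightarrow>
          dist ((B s - B 0) / (s - 0)) (?c * pderiv_ax i F z) < e"
        by blast
    qed
    then have "(B has_real_derivative ?c * pderiv_ax i F z) (at 0)"
      by (simp add: has_field_derivative_iff)
    from DERIV_add[OF this insert.IH[folded w_def]] insert.hyps show ?case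
      by (simp add: B_def w_def scaleR_add_right add_ac)
  qed
  have "(\<Sum>i\<in>UNIV. (v $ i) *\<^sub>R axis i 1) = v"
    using basis_expansion[of v] by (simp add: scalar_mult_eq_scaleR)
  then show ?thesis using main[of UNIV] by simp
qed

section \<open>Existence, uniqueness and location of generalized means\<close>

text \<open>The kernel is continuous and has no zero on the convex, hence connected, triangle \<open>y < u\<close>. The
  number \<open>\<sigma>\<close> is \<open>1\<close> or \<open>-1\<close>; a factor is used in place of two cases because the arguments
  below are symmetric in the sign.\<close>

lemma chebyshev_system_constant_sign:
  assumes I: "is_interval I" and ch: "chebyshev_system I f g"
  obtains \<sigma> where "\<And>u y. u \<in> I \<Longrightarrow> y \<in> I \<Longrightarrow> y < u \<Longrightarrow> \<sigma> * DD f g u y > 0"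
proof -
  define P where "P = {z \<in> I \<times> I. snd z < fst z}"
  have "P = (I \<times> I) \<inter> {z. inner (-1, 1) z < 0}"
    by (auto simp: P_def inner_prod_def)
  moreover have "convex (I \<times> I)"
    using I by (intro convex_Times) (simp_all add: is_interval_convex)
  ultimately have "convex P"
    by (simp add: convex_Int convex_halfspace_lt)
  then have "connected P" by (rule convex_connected)
  have cf: "continuous_on I f" and cg: "continuous_on I g"
    and nz: "\<And>x y. x \<in> I \<Longrightarrow> y \<in> I \<Longrightarrow> x \<noteq> y \<Longrightarrow> DD f g x y \<noteq> 0"
    using ch by (auto simp: chebyshev_system_def)
  have "continuous_on P (\<lambda>z. DD f g (fst z) (snd z))"
    unfolding DD_def
    by (intro continuous_intros continuous_on_compose2[OF cf] continuous_on_compose2[OF cg])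
       (auto simp: P_def)
  with \<open>connected P\<close> have conn: "connected ((\<lambda>z. DD f g (fst z) (snd z)) ` P)"
    by (rule connected_continuous_image[rotated])
  have "0 \<notin> (\<lambda>z. DD f g (fst z) (snd z)) ` P"
    using nz by (fastforce simp: P_def)
  with conn have "(\<forall>z\<in>P. DD f g (fst z) (snd z) > 0) \<or> (\<forall>z\<in>P. DD f g (fst z) (snd z) < 0)"
    unfolding connected_iff_interval
    by (smt (verit, ccfv_threshold) image_eqI)
  then show thesis
  proof
    assume "\<forall>z\<in>P. DD f g (fst z) (snd z) > 0"
    then show thesis by (intro that[of 1]) (auto simp: P_def)
  next
    assume "\<forall>z\<in>P. DD f g (fst z) (snd z) < 0"
    then show thesis by (intro that[of "-1"]) (auto simp: P_def)
  qed
qed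

lemma (in prob_space) integrable_continuous_image:
  fixes \<phi> :: "real \<Rightarrow> real"
  assumes p: "p \<in> borel_measurable M" "\<And>t. t \<in> space M \<Longrightarrow> p t \<in> {a..b}"
    and \<phi>: "continuous_on {a..b} \<phi>"
  shows "integrable M (\<lambda>t. \<phi> (p t))"
proof -
  have "\<phi> \<in> borel_measurable (restrict_space borel {a..b})"
    by (rule borel_measurable_continuous_on_restrict[OF \<phi>])
  moreover have "p \<in> measurable M (restrict_space borel {a..b})"
    using p by (intro measurable_restrict_space2) auto
  ultimately have "(\<lambda>t. \<phi> (p t)) \<in> borel_measurable M"
    by (rule measurable_compose[rotated])
  moreover have "bounded (\<phi> ` {a..b})"
    by (intro compact_imp_bounded compact_continuous_image \<phi>) simp
  then obtain B where "\<And>z. z \<in> {a..b} \<Longrightarrow> norm (\<phi> z) \<le> B"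
    unfolding bounded_iff by blast
  ultimately show ?thesis
    using p(2) by (intro integrable_const_bound[where B = B]) auto
qed

text \<open>The integral \<open>A * g y - f y * B\<close>, with \<open>A\<close> and \<open>B\<close> the integrals of \<open>f \<circ> p\<close> and \<open>g \<circ> p\<close>, is continuous in
  \<open>y\<close> and has opposite signs at \<open>a\<close> and \<open>b\<close>, because the kernel has a constant sign on either side of
  the diagonal; so it has a zero in between. Two distinct zeros would force \<open>A = B = 0\<close> by the Chebyshev
  property, and then the integral would vanish identically. But to the left of \<open>a\<close> the integrand has a
  strict sign.\<close>

lemma (in prob_space) chebyshev_mean_unique_exists:
  assumes I: "open I" "is_interval I" and ch: "chebyshev_system I f g"
    and p: "p \<in> borel_measurable M" "\<And>t. t \<in> space M \<Longrightarrow> p t \<in> {a..b}"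
    and ab: "{a..b} \<subseteq> I"
  obtains y where "y \<in> {a..b}" "(\<integral>t. DD f g (p t) y \<partial>M) = 0"
    "\<And>z. z \<in> I \<Longrightarrow> (\<integral>t. DD f g (p t) z \<partial>M) = 0 \<Longrightarrow> z = y"
proof -
  obtain \<sigma> where \<sigma>: "\<And>u y. u \<in> I \<Longrightarrow> y \<in> I \<Longrightarrow> y < u \<Longrightarrow> \<sigma> * DD f g u y > 0"
    using chebyshev_system_constant_sign[OF I(2) ch] by blast
  have cf: "continuous_on I f" and cg: "continuous_on I g"
    and nz: "\<And>x y. x \<in> I \<Longrightarrow> y \<in> I \<Longrightarrow> x \<noteq> y \<Longrightarrow> DD f g x y \<noteq> 0"
    using ch by (auto simp: chebyshev_system_def)
  have intf: "integrable M (\<lambda>t. f (p t))" and intg: "integrable M (\<lambda>t. g (p t))"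
    using ab cf cg by (auto intro!: integrable_continuous_image[OF p] intro: continuous_on_subset)
  define A where "A = (\<integral>t. f (p t) \<partial>M)"
  define B where "B = (\<integral>t. g (p t) \<partial>M)"
  have int: "integrable M (\<lambda>t. DD f g (p t) y)" for y
    using intf intg by (simp add: DD_def)
  have eq: "(\<integral>t. DD f g (p t) y \<partial>M) = A * g y - f y * B" for y
    using intf intg by (simp add: DD_def A_def B_def)
  obtain t0 where "t0 \<in> space M" using not_empty by auto
  then have "a \<le> b" using p(2)[of t0] by auto
  then have abI: "a \<in> I" "b \<in> I" using ab by auto
  have DD_diag: "DD f g u u = 0" and DD_swap: "DD f g u v = - DD f g v u" for u v
    by (simp_all add: DD_def)
  define \<phi> where "\<phi> y = \<sigma> * (A * g y - f y * B)" for y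
  have \<phi>_eq: "\<phi> y = (\<integral>t. \<sigma> * DD f g (p t) y \<partial>M)" for y
    by (simp add: \<phi>_def eq)
  have "\<phi> b \<le> 0"
    unfolding \<phi>_eq
  proof (rule integral_le_const)
    show "integrable M (\<lambda>t. \<sigma> * DD f g (p t) b)" using int by simp
    show "AE t in M. \<sigma> * DD f g (p t) b \<le> 0"
    proof (rule AE_I2)
    fix t assume "t \<in> space M"
    then have "p t \<in> I" "p t \<le> b" using p(2)[of t] ab by auto
    then show "\<sigma> * DD f g (p t) b \<le> 0"
      using \<sigma>[of b "p t"] abI DD_swap[of "p t" b] DD_diag by (cases "p t = b") auto
    qed
  qed
  moreover have "0 \<le> \<phi> a"
    unfolding \<phi>_eq
  proof (rule Bochner_Integration.integral_nonneg)
    fix t assume "t \<in> space M"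
    then have "p t \<in> I" "a \<le> p t" using p(2)[of t] ab by auto
    then show "0 \<le> \<sigma> * DD f g (p t) a"
      using \<sigma>[of "p t" a] abI DD_diag by (cases "p t = a") auto
  qed
  moreover have "continuous_on {a..b} \<phi>"
    unfolding \<phi>_def using ab by (intro continuous_intros continuous_on_subset[OF cf] continuous_on_subset[OF cg])
  ultimately obtain y where y: "a \<le> y" "y \<le> b" "\<phi> y = 0"
    using IVT2'[of \<phi> b 0 a] \<open>a \<le> b\<close> by blast
  have "\<exists>z\<in>I. z < a"
  proof -
    obtain e where "e > 0" "ball a e \<subseteq> I"
      using I(1) abI(1) open_contains_ball by blast
    then show ?thesis
      by (intro bexI[of _ "a - e / 2"]) (auto simp: subset_iff dist_real_def)
  qed
  then obtain z0 where z0: "z0 \<in> I" "z0 < a" by blast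
  have "\<phi> z0 \<noteq> 0"
  proof
    assume "\<phi> z0 = 0"
    have pos: "0 < \<sigma> * DD f g (p t) z0" if "t \<in> space M" for t
      using \<sigma>[of "p t" z0] p(2)[OF that] ab z0 by fastforce
    have "AE t in M. \<sigma> * DD f g (p t) z0 = 0"
      using integral_nonneg_eq_0_iff_AE[of M "\<lambda>t. \<sigma> * DD f g (p t) z0"] \<open>\<phi> z0 = 0\<close> pos int
      by (auto simp: \<phi>_eq less_imp_le)
    then have "AE t in M. False"
      by (rule AE_mp) (metis (mono_tags, lifting) AE_I2 pos less_irrefl)
    then show False by simp
  qed
  then have "\<sigma> \<noteq> 0" and AB: "A \<noteq> 0 \<or> B \<noteq> 0" by (auto simp: \<phi>_def)
  have zero: "A * g y - f y * B = 0" using y(3) \<open>\<sigma> \<noteq> 0\<close> by (simp add: \<phi>_def)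
  show thesis
  proof (rule that[of y])
    show "y \<in> {a..b}" using y by simp
    show "(\<integral>t. DD f g (p t) y \<partial>M) = 0" using zero eq by simp
    fix z assume z: "z \<in> I" "(\<integral>t. DD f g (p t) z \<partial>M) = 0"
    have z': "A * g z - f z * B = 0" using z(2) eq by simp
    have "A * DD f g z y = f z * (A * g y - f y * B) - f y * (A * g z - f z * B)"
      by (simp add: DD_def algebra_simps)
    moreover have "B * DD f g z y = g z * (A * g y - f y * B) - g y * (A * g z - f z * B)"
      by (simp add: DD_def algebra_simps)
    ultimately have "DD f g z y = 0" using AB zero z' by auto
    then show "z = y" using nz[of z y] z(1) y(1,2) subsetD[OF ab, of y] by auto
  qed
qed

text \<open>This justifies the definite description in \<^const>\<open>gen_mean\<close>. The interval \<open>{a..b}\<close> is any one within \<open>I\<close>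
  that contains all coordinates of \<open>x\<close>; near the diagonal it can be taken small, which localizes both
  the family of means and the generalized mean.\<close>

lemma gen_mean_solves:
  fixes x :: "real ^ 'd::finite"
  assumes I: "open I" "is_interval I" and \<mu>: "prob_space \<mu>"
    and ch: "chebyshev_system I f g" and m: "measurable_family I \<mu> m"
    and x: "x \<in> cube I" "\<And>i. x $ i \<in> {a..b}" and ab: "{a..b} \<subseteq> I"
  shows "gen_mean I f g m \<mu> x \<in> {a..b}" (is ?A)
    and "(\<integral>t. DD f g (m x t) (gen_mean I f g m \<mu> x) \<partial>\<mu>) = 0" (is ?B)
    and "\<And>t. t \<in> space \<mu> \<Longrightarrow> m x t \<in> {a..b}" (is "PROP ?C")
proof -
  interpret prob_space \<mu> by (rule \<mu>)
  show C: "m x t \<in> {a..b}" if t: "t \<in> space \<mu>" for t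
  proof -
    have "Min (range (($) x)) \<le> m x t" "m x t \<le> Max (range (($) x))"
      using m t x(1) by (auto simp: measurable_family_def mean_on_def)
    moreover have "a \<le> Min (range (($) x))" "Max (range (($) x)) \<le> b"
      using x(2) by (auto simp: Min_ge_iff Max_le_iff)
    ultimately show ?thesis unfolding atLeastAtMost_iff by (meson order_trans)
  qed
  have meas: "m x \<in> borel_measurable \<mu>"
    using m x(1) by (simp add: measurable_family_def)
  obtain y where y: "y \<in> {a..b}" "(\<integral>t. DD f g (m x t) y \<partial>\<mu>) = 0"
    "\<And>z. z \<in> I \<Longrightarrow> (\<integral>t. DD f g (m x t) z \<partial>\<mu>) = 0 \<Longrightarrow> z = y"
    using chebyshev_mean_unique_exists[OF I ch meas C ab] by blast
  have "gen_mean I f g m \<mu> x = y"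
    unfolding gen_mean_def using y ab by (intro the_equality) auto
  with y show ?A ?B by simp_all
qed

section \<open>Moments forced by vanishing integrals\<close>

text \<open>If \<open>G u y = L * (u - y) ^ k + o(\<bar>u - y\<bar> ^ k)\<close> near \<open>(x, x)\<close> and the integral of \<open>G (p n t) (y n)\<close> vanishes,
  then so does that of the leading term, up to \<open>o(s n ^ k)\<close>: the distances of \<open>p n t\<close> and \<open>y n\<close> from \<open>x\<close> are at
  most \<open>s n * C\<close>, uniformly in \<open>t\<close>, so the error term is bounded by a small constant times \<open>(2 * s n * C) ^ k\<close>.\<close>

lemma (in prob_space) scaled_moment_tendsto_0:
  fixes G :: "real \<Rightarrow> real \<Rightarrow> real"
  assumes exp: "\<And>\<epsilon>. \<epsilon> > 0 \<Longrightarrow> \<exists>\<delta>>0. \<forall>u y. \<bar>u - x\<bar> \<le> \<delta> \<longrightarrow> \<bar>y - x\<bar> \<le> \<delta> \<longrightarrow>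
        \<bar>G u y - L * (u - y) ^ k\<bar> \<le> \<epsilon> * \<bar>u - y\<bar> ^ k"
    and s: "\<And>n. s n > 0" "s \<longlonglongrightarrow> 0"
    and p: "\<And>n. p n \<in> borel_measurable M" "\<And>n t. t \<in> space M \<Longrightarrow> \<bar>p n t - x\<bar> \<le> s n * C"
    and y: "\<And>n. \<bar>y n - x\<bar> \<le> s n * C"
    and G: "\<And>n. integrable M (\<lambda>t. G (p n t) (y n))" "\<And>n. (\<integral>t. G (p n t) (y n) \<partial>M) = 0"
  shows "(\<lambda>n. L * (\<integral>t. ((p n t - y n) / s n) ^ k \<partial>M)) \<longlonglongrightarrow> 0"
proof (rule LIMSEQ_I)
  fix e :: real assume "e > 0"
  have "C \<ge> 0" using y[of 0] s(1)[of 0] by (smt (verit) mult_pos_neg)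
  have q: "\<bar>(p n t - y n) / s n\<bar> \<le> 2 * C" if "t \<in> space M" for n t
    using p(2)[OF that, of n] y[of n] s(1)[of n] by (simp add: field_simps abs_le_iff)
  have K: "(2 * C) ^ k + 1 > 0" using \<open>C \<ge> 0\<close> by (simp add: add_nonneg_pos)
  \<comment> \<open>The summand \<open>1\<close> only keeps the denominator positive when \<open>C = 0\<close>.\<close>
  define \<epsilon> where "\<epsilon> = e / ((2 * C) ^ k + 1)"
  have "\<epsilon> > 0" using \<open>e > 0\<close> K by (simp add: \<epsilon>_def)
  from exp[OF this] obtain \<delta> where \<delta>: "\<delta> > 0"
    "\<And>u y. \<bar>u - x\<bar> \<le> \<delta> \<Longrightarrow> \<bar>y - x\<bar> \<le> \<delta> \<Longrightarrow> \<bar>G u y - L * (u - y) ^ k\<bar> \<le> \<epsilon> * \<bar>u - y\<bar> ^ k"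
    by blast
  have "(\<lambda>n. s n * C) \<longlonglongrightarrow> 0" using tendsto_mult_left_zero[OF s(2)] .
  then have "eventually (\<lambda>n. s n * C < \<delta>) sequentially"
    using \<delta>(1) by (rule order_tendstoD)
  then obtain N where N: "\<And>n. n \<ge> N \<Longrightarrow> s n * C < \<delta>"
    by (auto simp: eventually_sequentially)
  have "norm (L * (\<integral>t. ((p n t - y n) / s n) ^ k \<partial>M) - 0) < e" if n: "n \<ge> N" for n
  proof -
    define q where "q t = (p n t - y n) / s n" for t
    have qi: "integrable M (\<lambda>t. q t ^ k)"
    proof (rule integrable_const_bound[where B = "(2 * C) ^ k"])
      show "AE t in M. norm (q t ^ k) \<le> (2 * C) ^ k"
        using q[of _ n] unfolding q_def real_norm_def power_abs by (intro AE_I2 power_mono) auto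
    qed (use p(1) in \<open>simp add: q_def\<close>)
    have "L * (\<integral>t. q t ^ k \<partial>M) = (\<integral>t. L * q t ^ k - G (p n t) (y n) / s n ^ k \<partial>M)"
      using G qi by simp
    moreover have "norm (\<integral>t. L * q t ^ k - G (p n t) (y n) / s n ^ k \<partial>M) \<le> \<epsilon> * (2 * C) ^ k"
    proof -
      have "norm (\<integral>t. L * q t ^ k - G (p n t) (y n) / s n ^ k \<partial>M)
          \<le> (\<integral>t. norm (L * q t ^ k - G (p n t) (y n) / s n ^ k) \<partial>M)"
        by (rule integral_norm_bound)
      also have "\<dots> \<le> \<epsilon> * (2 * C) ^ k"
      proof (rule integral_le_const)
        show "integrable M (\<lambda>t. norm (L * q t ^ k - G (p n t) (y n) / s n ^ k))"
          using G qi by simp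
        show "AE t in M. norm (L * q t ^ k - G (p n t) (y n) / s n ^ k) \<le> \<epsilon> * (2 * C) ^ k"
        proof (rule AE_I2)
          fix t assume t: "t \<in> space M"
          have "\<bar>G (p n t) (y n) - L * (p n t - y n) ^ k\<bar> \<le> \<epsilon> * \<bar>p n t - y n\<bar> ^ k"
            using p(2)[OF t, of n] y[of n] N[OF n] by (intro \<delta>(2)) auto
          then have "\<bar>G (p n t) (y n) - L * (p n t - y n) ^ k\<bar> / s n ^ k \<le> \<epsilon> * \<bar>p n t - y n\<bar> ^ k / s n ^ k"
            using s(1)[of n] by (intro divide_right_mono) auto
          moreover have "L * q t ^ k - G (p n t) (y n) / s n ^ k = - ((G (p n t) (y n) - L * (p n t - y n) ^ k) / s n ^ k)"
            unfolding q_def power_divide by (simp add: diff_divide_distrib)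
          ultimately have "norm (L * q t ^ k - G (p n t) (y n) / s n ^ k) \<le> \<epsilon> * \<bar>q t\<bar> ^ k"
            using s(1)[of n] by (simp add: q_def abs_divide power_divide)
          also have "\<dots> \<le> \<epsilon> * (2 * C) ^ k"
            using q[OF t, of n] \<open>\<epsilon> > 0\<close> by (intro mult_left_mono power_mono) (auto simp: q_def)
          finally show "norm (L * q t ^ k - G (p n t) (y n) / s n ^ k) \<le> \<epsilon> * (2 * C) ^ k" .
        qed
      qed
      finally show ?thesis .
    qed
    moreover have "\<epsilon> * (2 * C) ^ k < \<epsilon> * ((2 * C) ^ k + 1)" using \<open>\<epsilon> > 0\<close> by simp
    moreover have "\<epsilon> * ((2 * C) ^ k + 1) = e" using K by (simp add: \<epsilon>_def)
    ultimately show ?thesis by (simp add: q_def)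
  qed
  then show "\<exists>N. \<forall>n\<ge>N. norm (L * (\<integral>t. ((p n t - y n) / s n) ^ k \<partial>M) - 0) < e" by blast
qed

text \<open>The function \<open>E\<close>, with the nonzero leading coefficient \<open>W\<close> of order one, is there to locate \<open>y n\<close> to first order:
  by the previous lemma with exponent one, \<open>(y n - x) / s n\<close> has the same limit as the mean value of
  \<open>(p n t - x) / s n\<close>, which is the mean value of \<open>d\<close>. Hence \<open>(p n t - y n) / s n\<close> tends boundedly to the centred
  function \<open>d t - (\<integral>t. d t \<partial>M)\<close>, and the previous lemma for \<open>G\<close> passes to the limit.\<close>

lemma (in prob_space) central_moment_vanishes:
  fixes G E :: "real \<Rightarrow> real \<Rightarrow> real"
  assumes E: "\<And>\<epsilon>. \<epsilon> > 0 \<Longrightarrow> \<exists>\<delta>>0. \<forall>u y. \<bar>u - x\<bar> \<le> \<delta> \<longrightarrow> \<bar>y - x\<bar> \<le> \<delta> \<longrightarrow>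
        \<bar>E u y - W * (u - y) ^ 1\<bar> \<le> \<epsilon> * \<bar>u - y\<bar> ^ 1" and "W \<noteq> 0"
    and G: "\<And>\<epsilon>. \<epsilon> > 0 \<Longrightarrow> \<exists>\<delta>>0. \<forall>u y. \<bar>u - x\<bar> \<le> \<delta> \<longrightarrow> \<bar>y - x\<bar> \<le> \<delta> \<longrightarrow>
        \<bar>G u y - L * (u - y) ^ k\<bar> \<le> \<epsilon> * \<bar>u - y\<bar> ^ k"
    and s: "\<And>n. s n > 0" "s \<longlonglongrightarrow> 0"
    and p: "\<And>n. p n \<in> borel_measurable M" "\<And>n t. t \<in> space M \<Longrightarrow> \<bar>p n t - x\<bar> \<le> s n * C"
    and y: "\<And>n. \<bar>y n - x\<bar> \<le> s n * C"
    and E_int: "\<And>n. integrable M (\<lambda>t. E (p n t) (y n))" "\<And>n. (\<integral>t. E (p n t) (y n) \<partial>M) = 0"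
    and G_int: "\<And>n. integrable M (\<lambda>t. G (p n t) (y n))" "\<And>n. (\<integral>t. G (p n t) (y n) \<partial>M) = 0"
    and d: "d \<in> borel_measurable M" "\<And>t. t \<in> space M \<Longrightarrow> (\<lambda>n. (p n t - x) / s n) \<longlonglongrightarrow> d t"
  shows "L * (\<integral>t. (d t - (\<integral>t. d t \<partial>M)) ^ k \<partial>M) = 0"
proof -
  have "C \<ge> 0" using y[of 0] s(1)[of 0] by (smt (verit) mult_pos_neg)
  have p_bd: "\<bar>(p n t - x) / s n\<bar> \<le> C" if "t \<in> space M" for n t
    using p(2)[OF that, of n] s(1)[of n] by (simp add: field_simps)
  have q_bd: "\<bar>(p n t - y n) / s n\<bar> \<le> 2 * C" if "t \<in> space M" for n t
    using p(2)[OF that, of n] y[of n] s(1)[of n] by (simp add: field_simps abs_le_iff)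
  have p_int: "integrable M (\<lambda>t. (p n t - x) / s n)" for n
    using p_bd p(1) by (intro integrable_const_bound[where B = C]) auto
  have 1: "(\<lambda>n. \<integral>t. (p n t - x) / s n \<partial>M) \<longlonglongrightarrow> (\<integral>t. d t \<partial>M)"
    using d p(1) p_bd by (intro integral_dominated_convergence[where w = "\<lambda>_. C"]) auto
  have "(\<lambda>n. (W * (\<integral>t. ((p n t - y n) / s n) ^ 1 \<partial>M)) / W) \<longlonglongrightarrow> 0 / W"
    using \<open>W \<noteq> 0\<close> by (intro tendsto_divide scaled_moment_tendsto_0[OF E s p y E_int]) auto
  then have "(\<lambda>n. \<integral>t. (p n t - y n) / s n \<partial>M) \<longlonglongrightarrow> 0" using \<open>W \<noteq> 0\<close> by simp
  moreover have "(\<integral>t. (p n t - y n) / s n \<partial>M) = (\<integral>t. (p n t - x) / s n \<partial>M) - (y n - x) / s n" for n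
  proof -
    have "(\<integral>t. (p n t - y n) / s n \<partial>M) = (\<integral>t. (p n t - x) / s n - (y n - x) / s n \<partial>M)"
      by (simp add: diff_divide_distrib)
    also have "\<dots> = (\<integral>t. (p n t - x) / s n \<partial>M) - (\<integral>t. (y n - x) / s n \<partial>M)"
      by (intro Bochner_Integration.integral_diff p_int) auto
    finally show ?thesis by (simp add: prob_space)
  qed
  ultimately have "(\<lambda>n. (\<integral>t. (p n t - x) / s n \<partial>M) - (y n - x) / s n) \<longlonglongrightarrow> 0" by simp
  from tendsto_diff[OF 1 this] have 2: "(\<lambda>n. (y n - x) / s n) \<longlonglongrightarrow> (\<integral>t. d t \<partial>M)" by simp
  have "(\<lambda>n. ((p n t - y n) / s n) ^ k) \<longlonglongrightarrow> (d t - (\<integral>t. d t \<partial>M)) ^ k" if "t \<in> space M" for t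
  proof -
    have "(\<lambda>n. ((p n t - x) / s n - (y n - x) / s n) ^ k) \<longlonglongrightarrow> (d t - (\<integral>t. d t \<partial>M)) ^ k"
      by (intro tendsto_intros d that 2)
    then show ?thesis by (simp add: diff_divide_distrib)
  qed
  moreover have "norm (((p n t - y n) / s n) ^ k) \<le> (2 * C) ^ k" if "t \<in> space M" for n t
    using q_bd[OF that, of n] unfolding real_norm_def power_abs by (intro power_mono) auto
  ultimately have "(\<lambda>n. \<integral>t. ((p n t - y n) / s n) ^ k \<partial>M) \<longlonglongrightarrow> (\<integral>t. (d t - (\<integral>t. d t \<partial>M)) ^ k \<partial>M)"
    using d(1) p(1) by (intro integral_dominated_convergence[where w = "\<lambda>_. (2 * C) ^ k"]) auto
  then have "(\<lambda>n. L * (\<integral>t. ((p n t - y n) / s n) ^ k \<partial>M)) \<longlonglongrightarrow> L * (\<integral>t. (d t - (\<integral>t. d t \<partial>M)) ^ k \<partial>M)"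
    by (rule tendsto_mult_left)
  moreover have "(\<lambda>n. L * (\<integral>t. ((p n t - y n) / s n) ^ k \<partial>M)) \<longlonglongrightarrow> 0"
    by (rule scaled_moment_tendsto_0[OF G s p y G_int])
  ultimately show ?thesis by (rule LIMSEQ_unique)
qed

section \<open>Taylor expansion of kernels at the diagonal\<close>

text \<open>Taylor's formula in the first variable, centred at \<open>y\<close>. The index \<open>j\<close> of \<open>Gd\<close> counts derivatives in the first
  variable; all coefficients below the order \<open>k\<close> vanish, and joint continuity of the \<open>k\<close>-th derivative
  makes the remainder uniform in \<open>y\<close> near \<open>x\<close>.\<close>

lemma vanishing_diagonal_expansion:
  fixes Gd :: "nat \<Rightarrow> real \<Rightarrow> real \<Rightarrow> real"
  assumes I: "open I" "x \<in> I" and k: "k > 0"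
    and deriv: "\<And>j u y. j < k \<Longrightarrow> u \<in> I \<Longrightarrow> y \<in> I \<Longrightarrow>
        ((\<lambda>u. Gd j u y) has_real_derivative Gd (Suc j) u y) (at u)"
    and diagonal: "\<And>j y. j < k \<Longrightarrow> y \<in> I \<Longrightarrow> Gd j y y = 0"
    and cont: "isCont (\<lambda>z. Gd k (fst z) (snd z)) (x, x)"
    and \<epsilon>: "\<epsilon> > 0"
  shows "\<exists>\<delta>>0. \<forall>u y. \<bar>u - x\<bar> \<le> \<delta> \<longrightarrow> \<bar>y - x\<bar> \<le> \<delta> \<longrightarrow>
        \<bar>Gd 0 u y - Gd k x x / fact k * (u - y) ^ k\<bar> \<le> \<epsilon> * \<bar>u - y\<bar> ^ k"
proof -
  obtain r where r: "r > 0" "cball x r \<subseteq> I" using I open_contains_cball by blast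
  obtain d where d: "d > 0"
    "\<And>z. dist z (x, x) < d \<Longrightarrow> dist (Gd k (fst z) (snd z)) (Gd k x x) < \<epsilon>"
    using cont \<epsilon> unfolding continuous_at_eps_delta by auto
  define \<delta> where "\<delta> = min r (d / 3)"
  have "\<delta> > 0" using r d by (simp add: \<delta>_def)
  moreover have "\<bar>Gd 0 u y - Gd k x x / fact k * (u - y) ^ k\<bar> \<le> \<epsilon> * \<bar>u - y\<bar> ^ k"
    if u: "\<bar>u - x\<bar> \<le> \<delta>" and y: "\<bar>y - x\<bar> \<le> \<delta>" for u y
  proof (cases "u = y")
    case True
    have "u \<in> I" using u r by (auto simp: \<delta>_def subset_iff dist_real_def abs_minus_commute)
    then show ?thesis using True diagonal[of 0 u] k by (simp add: power_0_left)
  next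
    case False
    have sub: "t \<in> I" if "x - \<delta> \<le> t" "t \<le> x + \<delta>" for t
    proof -
      have "\<bar>x - t\<bar> \<le> r" using that unfolding \<delta>_def by linarith
      then show ?thesis using r(2) by (auto simp: subset_iff dist_real_def)
    qed
    have "y \<in> I" using y by (intro sub) (auto simp: abs_le_iff)
    have "\<exists>t. (if u < y then u < t \<and> t < y else y < t \<and> t < u) \<and>
      Gd 0 u y = (\<Sum>j<k. Gd j y y / fact j * (u - y) ^ j) + Gd k t y / fact k * (u - y) ^ k"
      using deriv sub \<open>y \<in> I\<close> u y False k
      by (intro Taylor[where a = "x - \<delta>" and b = "x + \<delta>" and diff = "\<lambda>j u. Gd j u y"]) (auto simp: abs_le_iff)
    then obtain t where t: "if u < y then u < t \<and> t < y else y < t \<and> t < u"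
      and eq: "Gd 0 u y = Gd k t y / fact k * (u - y) ^ k"
      using diagonal \<open>y \<in> I\<close> by auto
    have "\<bar>t - x\<bar> \<le> \<delta>" using t u y by (auto simp: abs_le_iff split: if_splits)
    have "dist (t, y) (x, x) \<le> dist t x + dist y x"
      using norm_Pair_le[of "t - x" "y - x"] by (simp add: dist_norm)
    also have "\<dots> < d" using \<open>\<bar>t - x\<bar> \<le> \<delta>\<close> y d(1) by (auto simp: dist_real_def \<delta>_def)
    finally have "\<bar>Gd k t y - Gd k x x\<bar> < \<epsilon>" using d(2)[of "(t, y)"] by (simp add: dist_real_def)
    moreover have "\<bar>Gd k t y - Gd k x x\<bar> / fact k \<le> \<bar>Gd k t y - Gd k x x\<bar>"
      using divide_left_mono[of 1 "fact k" "\<bar>Gd k t y - Gd k x x\<bar>"] by simp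
    ultimately have "\<bar>Gd k t y - Gd k x x\<bar> / fact k * \<bar>u - y\<bar> ^ k \<le> \<epsilon> * \<bar>u - y\<bar> ^ k"
      by (intro mult_right_mono) auto
    moreover have "Gd 0 u y - Gd k x x / fact k * (u - y) ^ k = (Gd k t y - Gd k x x) / fact k * (u - y) ^ k"
      unfolding eq by (simp add: diff_divide_distrib left_diff_distrib)
    ultimately show ?thesis by (simp add: abs_mult power_abs)
  qed
  ultimately show ?thesis by blast
qed

lemma cont_differentiable_has_deriv:
  assumes "cont_differentiable n I f" "j < n" "x \<in> I"
  shows "((deriv ^^ j) f has_real_derivative (deriv ^^ Suc j) f x) (at x)"
  using assms by (simp add: cont_differentiable_def field_differentiable_derivI)

lemma cont_differentiable_isCont:
  assumes "cont_differentiable n I f" "j \<le> n" "x \<in> I" "open I"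
  shows "isCont ((deriv ^^ j) f) x"
proof (cases "j = n")
  case True
  with assms show ?thesis
    by (simp add: cont_differentiable_def continuous_on_eq_continuous_at)
next
  case False
  with assms show ?thesis
    using cont_differentiable_has_deriv[of n I f j x] by (auto intro: DERIV_isCont)
qed

lemma cont_differentiable_mono:
  assumes "cont_differentiable n I f" "k \<le> n" "open I"
  shows "cont_differentiable k I f"
  using assms cont_differentiable_isCont[OF assms(1,2) _ assms(3)]
  by (auto simp: cont_differentiable_def intro: continuous_at_imp_continuous_on)

text \<open>The kernels compared below are sums of products of a smooth function of \<open>u\<close> and a merely continuous
  coefficient in \<open>y\<close>. Four summands cover a combination of the kernels of two pairs.\<close>

lemma pair_combination_expansion:
  fixes a b c d f g h l :: "real \<Rightarrow> real"
  defines "Gd \<equiv> \<lambda>j u y. (deriv ^^ j) f u * a y + (deriv ^^ j) g u * b y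
      + (deriv ^^ j) h u * c y + (deriv ^^ j) l u * d y"
  assumes I: "open I" "x \<in> I" and k: "k > 0"
    and F: "cont_differentiable k I f" "cont_differentiable k I g"
      "cont_differentiable k I h" "cont_differentiable k I l"
    and coeff: "isCont a x" "isCont b x" "isCont c x" "isCont d x"
    and diagonal: "\<And>j y. j < k \<Longrightarrow> y \<in> I \<Longrightarrow> Gd j y y = 0"
    and \<epsilon>: "\<epsilon> > 0"
  shows "\<exists>\<delta>>0. \<forall>u y. \<bar>u - x\<bar> \<le> \<delta> \<longrightarrow> \<bar>y - x\<bar> \<le> \<delta> \<longrightarrow>
        \<bar>Gd 0 u y - Gd k x x / fact k * (u - y) ^ k\<bar> \<le> \<epsilon> * \<bar>u - y\<bar> ^ k"
proof (rule vanishing_diagonal_expansion[OF I k _ diagonal _ \<epsilon>])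
  show "((\<lambda>u. Gd j u y) has_real_derivative Gd (Suc j) u y) (at u)"
    if "j < k" "u \<in> I" for j u y
    unfolding Gd_def using that F
    by (intro DERIV_add DERIV_cmult_right cont_differentiable_has_deriv) auto
  have *: "isCont (\<lambda>z. \<phi> (fst z)) (x, x)" "isCont (\<lambda>z. \<phi> (snd z)) (x, x)"
    if "isCont \<phi> x" for \<phi> :: "real \<Rightarrow> real"
    using that by (auto intro: isCont_o2[where g = \<phi> and f = fst] isCont_o2[where g = \<phi> and f = snd])
  show "isCont (\<lambda>z. Gd k (fst z) (snd z)) (x, x)"
    unfolding Gd_def using F I coeff
    by (intro continuous_intros * cont_differentiable_isCont) auto
qed

section \<open>Pairs as fundamental systems of a second-order equation\<close>

lemma chebyshev_classD:
  assumes "(f, g) \<in> chebyshev_class n I"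
  shows "cont_differentiable n I f" "cont_differentiable n I g" "chebyshev_system I f g"
    "\<And>x. x \<in> I \<Longrightarrow> wronskian f g x \<noteq> 0"
  using assms by (auto simp: chebyshev_class_def)

lemma cont_differentiable_derivs:
  assumes "cont_differentiable n I f" "x \<in> I"
  shows "0 < n \<Longrightarrow> (f has_real_derivative deriv f x) (at x)"
    and "1 < n \<Longrightarrow> (deriv f has_real_derivative deriv (deriv f) x) (at x)"
    and "2 < n \<Longrightarrow> (deriv (deriv f) has_real_derivative deriv (deriv (deriv f)) x) (at x)"
  using cont_differentiable_has_deriv[OF assms(1) _ assms(2), of 0]
    cont_differentiable_has_deriv[OF assms(1) _ assms(2), of 1]
    cont_differentiable_has_deriv[OF assms(1) _ assms(2), of 2]
  by (simp_all add: numeral_2_eq_2)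

lemma wronskian_has_real_derivative:
  assumes "cont_differentiable n I f" "cont_differentiable n I g" "1 < n" "x \<in> I"
  shows "(wronskian f g has_real_derivative
           deriv (deriv f) x * g x - f x * deriv (deriv g) x) (at x)"
proof -
  note [derivative_intros] =
    cont_differentiable_derivs(1,2)[OF assms(1,4)] cont_differentiable_derivs(1,2)[OF assms(2,4)]
  have "((\<lambda>x. deriv f x * g x - f x * deriv g x) has_real_derivative
           deriv (deriv f) x * g x - f x * deriv (deriv g) x) (at x)"
    using assms(3) by (auto intro!: derivative_eq_intros)
  then show ?thesis by (simp add: wronskian_def[abs_def])
qed

text \<open>Both functions of a pair solve the equation \<open>Y'' = \<Phi> Y' + \<Psi> Y\<close>: its coefficients are what Cramer's rule
  gives.\<close>

lemma Phi_Psi_linear_ode: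
  assumes "wronskian f g x \<noteq> 0"
  shows "deriv (deriv f) x = Phi f g x * deriv f x + Psi f g x * f x"
    and "deriv (deriv g) x = Phi f g x * deriv g x + Psi f g x * g x"
proof -
  have quot: "(a * p - b * q) / w = a / w * p + - (b / w) * q" for a b p q w :: real
    by (simp add: diff_divide_distrib)
  have "deriv (deriv f) x * wronskian f g x =
      (deriv (deriv f) x * g x - f x * deriv (deriv g) x) * deriv f x
      - (deriv (deriv f) x * deriv g x - deriv f x * deriv (deriv g) x) * f x"
    by (simp add: wronskian_def algebra_simps)
  then have "deriv (deriv f) x = ((deriv (deriv f) x * g x - f x * deriv (deriv g) x) * deriv f x
      - (deriv (deriv f) x * deriv g x - deriv f x * deriv (deriv g) x) * f x) / wronskian f g x"
    by (simp only: nonzero_eq_divide_eq[OF assms])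
  then show "deriv (deriv f) x = Phi f g x * deriv f x + Psi f g x * f x"
    by (simp only: Phi_def Psi_def quot)
  have "deriv (deriv g) x * wronskian f g x =
      (deriv (deriv f) x * g x - f x * deriv (deriv g) x) * deriv g x
      - (deriv (deriv f) x * deriv g x - deriv f x * deriv (deriv g) x) * g x"
    by (simp add: wronskian_def algebra_simps)
  then have "deriv (deriv g) x = ((deriv (deriv f) x * g x - f x * deriv (deriv g) x) * deriv g x
      - (deriv (deriv f) x * deriv g x - deriv f x * deriv (deriv g) x) * g x) / wronskian f g x"
    by (simp only: nonzero_eq_divide_eq[OF assms])
  then show "deriv (deriv g) x = Phi f g x * deriv g x + Psi f g x * g x"
    by (simp only: Phi_def Psi_def quot)
qed

text \<open>Abel's identity: the Wronskian of any two solutions of \<open>Y'' = \<Phi> Y' + \<Psi> Y\<close> satisfies \<open>W' = \<Phi> W\<close>, so the quotient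
  of two Wronskians has derivative zero.\<close>

lemma wronskian_ratio_constant:
  assumes I: "is_interval I"
    and F: "cont_differentiable n I u" "cont_differentiable n I v" "1 < n"
    and hl: "(h, l) \<in> chebyshev_class n I"
    and ode: "\<And>x. x \<in> I \<Longrightarrow> deriv (deriv u) x = Phi h l x * deriv u x + Psi h l x * u x"
      "\<And>x. x \<in> I \<Longrightarrow> deriv (deriv v) x = Phi h l x * deriv v x + Psi h l x * v x"
  shows "\<exists>c. \<forall>x\<in>I. wronskian u v x = c * wronskian h l x"
proof -
  note hlD = chebyshev_classD[OF hl]
  have "\<exists>c. \<forall>x\<in>I. wronskian u v x / wronskian h l x = c"
  proof (rule has_field_derivative_zero_constant)
    show "convex I" using I by (simp add: is_interval_convex)
    fix x assume x: "x \<in> I"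
    have "((\<lambda>x. wronskian u v x / wronskian h l x) has_real_derivative
       ((deriv (deriv u) x * v x - u x * deriv (deriv v) x) * wronskian h l x
        - wronskian u v x * (deriv (deriv h) x * l x - h x * deriv (deriv l) x))
       / (wronskian h l x * wronskian h l x)) (at x)"
      using hlD F x by (intro DERIV_divide wronskian_has_real_derivative) auto
    moreover have "deriv (deriv u) x * v x - u x * deriv (deriv v) x = Phi h l x * wronskian u v x"
      by (simp add: ode x wronskian_def algebra_simps)
    moreover have "deriv (deriv h) x * l x - h x * deriv (deriv l) x = Phi h l x * wronskian h l x"
      using hlD(4)[OF x] by (simp add: Phi_def)
    ultimately have "((\<lambda>x. wronskian u v x / wronskian h l x) has_real_derivative 0) (at x)"
      by (simp add: mult_ac)
    then show "((\<lambda>x. wronskian u v x / wronskian h l x) has_real_derivative 0) (at x within I)"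
      by (rule has_field_derivative_at_within)
  qed
  then obtain c where "\<And>x. x \<in> I \<Longrightarrow> wronskian u v x / wronskian h l x = c"
    by blast
  then have "\<forall>x\<in>I. wronskian u v x = c * wronskian h l x"
    using hlD(4) by (simp add: nonzero_divide_eq_eq)
  then show ?thesis ..
qed

text \<open>If the coefficients agree, all four functions solve the same equation. A uniqueness theorem for
  initial value problems is avoided by Cramer's rule: \<open>u * W(h, l) = W(u, l) * h + W(h, u) * l\<close> holds for every function
  \<open>u\<close>, and the two Wronskians on the right are constant multiples of \<open>W(h, l)\<close> when \<open>u\<close> is a solution.\<close>

lemma Phi_Psi_eq_imp_equivalent_pairs:
  assumes I: "is_interval I" "I \<noteq> {}" and n: "1 < n"
    and fg: "(f, g) \<in> chebyshev_class n I" and hl: "(h, l) \<in> chebyshev_class n I"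
    and eq: "\<And>x. x \<in> I \<Longrightarrow> Phi f g x = Phi h l x" "\<And>x. x \<in> I \<Longrightarrow> Psi f g x = Psi h l x"
  shows "equivalent_pairs I (f, g) (h, l)"
proof -
  note fgD = chebyshev_classD[OF fg] and hlD = chebyshev_classD[OF hl]
  have ode_f: "\<And>x. x \<in> I \<Longrightarrow> deriv (deriv f) x = Phi h l x * deriv f x + Psi h l x * f x"
    and ode_g: "\<And>x. x \<in> I \<Longrightarrow> deriv (deriv g) x = Phi h l x * deriv g x + Psi h l x * g x"
    using Phi_Psi_linear_ode[OF fgD(4)] eq by simp_all
  note ode_h = Phi_Psi_linear_ode(1)[OF hlD(4)] and ode_l = Phi_Psi_linear_ode(2)[OF hlD(4)]
  note const = wronskian_ratio_constant[OF I(1) _ _ n hl]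
  obtain \<alpha> where \<alpha>: "\<And>x. x \<in> I \<Longrightarrow> wronskian f l x = \<alpha> * wronskian h l x"
    using const[OF fgD(1) hlD(2) ode_f ode_l] by blast
  obtain \<beta> where \<beta>: "\<And>x. x \<in> I \<Longrightarrow> wronskian h f x = \<beta> * wronskian h l x"
    using const[OF hlD(1) fgD(1) ode_h ode_f] by blast
  obtain \<gamma> where \<gamma>: "\<And>x. x \<in> I \<Longrightarrow> wronskian g l x = \<gamma> * wronskian h l x"
    using const[OF fgD(2) hlD(2) ode_g ode_l] by blast
  obtain \<delta> where \<delta>: "\<And>x. x \<in> I \<Longrightarrow> wronskian h g x = \<delta> * wronskian h l x"
    using const[OF hlD(1) fgD(2) ode_h ode_g] by blast
  have cramer: "u x = a * h x + b * l x"
    if "x \<in> I" "wronskian u l x = a * wronskian h l x" "wronskian h u x = b * wronskian h l x" for u a b x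
  proof -
    have "u x * wronskian h l x = wronskian u l x * h x + wronskian h u x * l x"
      by (simp add: wronskian_def algebra_simps)
    also have "\<dots> = (a * h x + b * l x) * wronskian h l x"
      using that by (simp add: algebra_simps)
    finally show ?thesis using hlD(4)[OF that(1)] by simp
  qed
  obtain x where x: "x \<in> I" using I(2) by blast
  \<comment> \<open>Pluecker relation; it shows that the matrix of constants is invertible.\<close>
  have "wronskian f g x * wronskian h l x =
      wronskian f l x * wronskian h g x - wronskian h f x * wronskian g l x"
    by (simp add: wronskian_def algebra_simps)
  also have "\<dots> = (\<alpha> * \<delta> - \<beta> * \<gamma>) * (wronskian h l x * wronskian h l x)"
    using \<alpha>[OF x] \<beta>[OF x] \<gamma>[OF x] \<delta>[OF x] by (simp add: algebra_simps)
  finally have "\<alpha> * \<delta> - \<beta> * \<gamma> \<noteq> 0"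
    using fgD(4)[OF x] hlD(4)[OF x] by auto
  moreover have "\<forall>x\<in>I. f x = \<alpha> * h x + \<beta> * l x \<and> g x = \<gamma> * h x + \<delta> * l x"
    using cramer \<alpha> \<beta> \<gamma> \<delta> by blast
  ultimately show ?thesis unfolding equivalent_pairs_def by blast
qed

lemma deriv_linear_combination:
  fixes h l :: "real \<Rightarrow> real"
  assumes "open I" "x \<in> I" "\<And>y. y \<in> I \<Longrightarrow> f y = a * h y + b * l y"
    and "(h has_real_derivative h') (at x)" "(l has_real_derivative l') (at x)"
  shows "deriv f x = a * h' + b * l'"
proof (rule DERIV_imp_deriv)
  have "((\<lambda>y. a * h y + b * l y) has_real_derivative a * h' + b * l') (at x)"
    using assms by (intro DERIV_add DERIV_cmult)
  then show "(f has_real_derivative a * h' + b * l') (at x)"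
    by (rule has_field_derivative_transform_within_open[OF _ assms(1,2)]) (simp add: assms(3))
qed

text \<open>The Wronskian and the two other determinants of derivatives that occur in \<open>\<Phi>\<close> and \<open>\<Psi>\<close> are all multiplied by
  the determinant of the change of basis, which cancels.\<close>

lemma equivalent_pairs_imp_Phi_Psi_eq:
  assumes I: "open I" and n: "1 < n"
    and hl: "(h, l) \<in> chebyshev_class n I" and eq: "equivalent_pairs I (f, g) (h, l)" and x: "x \<in> I"
  shows "Phi f g x = Phi h l x" "Psi f g x = Psi h l x"
proof -
  note hlD = chebyshev_classD[OF hl]
  obtain \<alpha> \<beta> \<gamma> \<delta> where det: "\<alpha> * \<delta> - \<beta> * \<gamma> \<noteq> 0"
    and f: "\<And>x. x \<in> I \<Longrightarrow> f x = \<alpha> * h x + \<beta> * l x"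
    and g: "\<And>x. x \<in> I \<Longrightarrow> g x = \<gamma> * h x + \<delta> * l x"
    using eq unfolding equivalent_pairs_def by auto
  note h = cont_differentiable_derivs[OF hlD(1)] and l = cont_differentiable_derivs[OF hlD(2)]
  have f1: "deriv f x = \<alpha> * deriv h x + \<beta> * deriv l x"
    and g1: "deriv g x = \<gamma> * deriv h x + \<delta> * deriv l x" if "x \<in> I" for x
    using deriv_linear_combination[OF I that f h(1)[OF that] l(1)[OF that]]
      deriv_linear_combination[OF I that g h(1)[OF that] l(1)[OF that]] n by auto
  have f2: "deriv (deriv f) x = \<alpha> * deriv (deriv h) x + \<beta> * deriv (deriv l) x"
    and g2: "deriv (deriv g) x = \<gamma> * deriv (deriv h) x + \<delta> * deriv (deriv l) x"
    using deriv_linear_combination[OF I x f1 h(2)[OF x] l(2)[OF x]]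
      deriv_linear_combination[OF I x g1 h(2)[OF x] l(2)[OF x]] n by auto
  have W: "wronskian f g x = (\<alpha> * \<delta> - \<beta> * \<gamma>) * wronskian h l x"
    unfolding wronskian_def f[OF x] g[OF x] f1[OF x] g1[OF x] by (simp add: algebra_simps)
  have "deriv (deriv f) x * g x - f x * deriv (deriv g) x
      = (\<alpha> * \<delta> - \<beta> * \<gamma>) * (deriv (deriv h) x * l x - h x * deriv (deriv l) x)"
    unfolding f[OF x] g[OF x] f2 g2 by (simp add: algebra_simps)
  then show "Phi f g x = Phi h l x" using det by (simp add: Phi_def W)
  have "deriv (deriv f) x * deriv g x - deriv f x * deriv (deriv g) x
      = (\<alpha> * \<delta> - \<beta> * \<gamma>) * (deriv (deriv h) x * deriv l x - deriv h x * deriv (deriv l) x)"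
    unfolding f1[OF x] g1[OF x] f2 g2 by (simp add: algebra_simps)
  then show "Psi f g x = Psi h l x" using det by (simp add: Psi_def W)
qed

text \<open>A change of basis multiplies the kernel, and hence the integral that defines the mean, by the determinant
  of the change, so the zero stays the same.\<close>

lemma equivalent_pairs_imp_gen_mean_eq:
  fixes m :: "real ^ 'd::finite \<Rightarrow> 't \<Rightarrow> real"
  assumes m: "measurable_family I \<mu> m" and eq: "equivalent_pairs I (f, g) (h, l)" and x: "x \<in> cube I"
  shows "gen_mean I f g m \<mu> x = gen_mean I h l m \<mu> x"
proof -
  obtain \<alpha> \<beta> \<gamma> \<delta> where det: "\<alpha> * \<delta> - \<beta> * \<gamma> \<noteq> 0"
    and f: "\<And>x. x \<in> I \<Longrightarrow> f x = \<alpha> * h x + \<beta> * l x"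
    and g: "\<And>x. x \<in> I \<Longrightarrow> g x = \<gamma> * h x + \<delta> * l x"
    using eq unfolding equivalent_pairs_def by auto
  have mI: "m x t \<in> I" if "t \<in> space \<mu>" for t
    using m x that by (auto simp: measurable_family_def mean_on_def)
  have "(\<integral>t. DD f g (m x t) y \<partial>\<mu>) = (\<alpha> * \<delta> - \<beta> * \<gamma>) * (\<integral>t. DD h l (m x t) y \<partial>\<mu>)" if y: "y \<in> I" for y
  proof -
    have "(\<integral>t. DD f g (m x t) y \<partial>\<mu>) = (\<integral>t. (\<alpha> * \<delta> - \<beta> * \<gamma>) * DD h l (m x t) y \<partial>\<mu>)"
      by (intro Bochner_Integration.integral_cong refl)
         (simp add: DD_def f g y mI algebra_simps)
    then show ?thesis by simp
  qed
  then show ?thesis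
    unfolding gen_mean_def using det by (intro arg_cong[where f = The] ext) auto
qed

section \<open>Moments of linear combinations\<close>

text \<open>Polarization: \<open>6abc = (a+b+c)^3 - (a+b)^3 - (b+c)^3 - (a+c)^3 + a^3 + b^3 + c^3\<close>, so the cubic form determines the
  mixed moments.\<close>

lemma (in prob_space) cubic_moments_determine_trilinear:
  fixes q :: "'d::finite \<Rightarrow> 'a \<Rightarrow> real"
  assumes q: "\<And>r. q r \<in> borel_measurable M" "\<And>r t. t \<in> space M \<Longrightarrow> \<bar>q r t\<bar> \<le> B"
    and zero: "\<And>v :: real ^ 'd. (\<integral>t. (\<Sum>r\<in>UNIV. v $ r * q r t) ^ 3 \<partial>M) = 0"
  shows "(\<integral>t. q i t * q j t * q l t \<partial>M) = 0"
proof -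
  define S where "S v t = (\<Sum>r\<in>UNIV. v $ r * q r t)" for v :: "real ^ 'd" and t
  have S_add: "S (v + w) t = S v t + S w t" for v w t
    by (simp add: S_def sum.distrib algebra_simps)
  have "S (axis r 1) t = (\<Sum>r'\<in>UNIV. if r' = r then q r' t else 0)" for r t
    unfolding S_def by (intro sum.cong) (auto simp: axis_def)
  then have S_axis: "S (axis r 1) t = q r t" for r t by simp
  have int: "integrable M (\<lambda>t. S v t ^ 3)" for v
  proof (rule integrable_const_bound[where B = "(\<Sum>r\<in>UNIV. \<bar>v $ r\<bar> * B) ^ 3"])
    show "AE t in M. norm (S v t ^ 3) \<le> (\<Sum>r\<in>UNIV. \<bar>v $ r\<bar> * B) ^ 3"
    proof (rule AE_I2)
      fix t assume t: "t \<in> space M"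
      have "\<bar>S v t\<bar> \<le> (\<Sum>r\<in>UNIV. \<bar>v $ r * q r t\<bar>)" unfolding S_def by (rule sum_abs)
      also have "\<dots> \<le> (\<Sum>r\<in>UNIV. \<bar>v $ r\<bar> * B)"
        using q(2)[OF t] by (intro sum_mono) (auto simp: abs_mult intro!: mult_left_mono)
      finally show "norm (S v t ^ 3) \<le> (\<Sum>r\<in>UNIV. \<bar>v $ r\<bar> * B) ^ 3"
        unfolding real_norm_def power_abs by (intro power_mono) auto
    qed
    show "(\<lambda>t. S v t ^ 3) \<in> borel_measurable M" using q(1) unfolding S_def by measurable
  qed
  have zero': "(\<integral>t. S v t ^ 3 \<partial>M) = 0" for v using zero unfolding S_def .
  let ?e = "\<lambda>r. axis r 1 :: real ^ 'd"
  have eq: "q i t * q j t * q l t = (S (?e i + ?e j + ?e l) t ^ 3 - S (?e i + ?e j) t ^ 3 - S (?e j + ?e l) t ^ 3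
      - S (?e i + ?e l) t ^ 3 + S (?e i) t ^ 3 + S (?e j) t ^ 3 + S (?e l) t ^ 3) / 6" for t
    unfolding S_add S_axis by (simp add: power3_eq_cube algebra_simps)
  show ?thesis unfolding eq using int by (simp add: zero')
qed

lemma (in prob_space) quadratic_moments_determine_zero:
  fixes q :: "'d::finite \<Rightarrow> 'a \<Rightarrow> real"
  assumes q: "\<And>r. q r \<in> borel_measurable M" "\<And>r t. t \<in> space M \<Longrightarrow> \<bar>q r t\<bar> \<le> B"
    and zero: "\<And>v :: real ^ 'd. (\<integral>t. (\<Sum>r\<in>UNIV. v $ r * q r t) ^ 2 \<partial>M) = 0"
  shows "prob {t \<in> space M. \<forall>r. q r t = 0} = 1"
proof -
  have "AE t in M. q r t = 0" for r
  proof -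
    have "(\<Sum>r'\<in>UNIV. axis r 1 $ r' * q r' t) = (\<Sum>r'\<in>UNIV. if r' = r then q r' t else 0)" for t
      by (intro sum.cong) (auto simp: axis_def)
    then have "(\<integral>t. q r t ^ 2 \<partial>M) = 0" using zero[of "axis r 1"] by simp
    moreover have "integrable M (\<lambda>t. q r t ^ 2)"
    proof (rule integrable_const_bound[where B = "B ^ 2"])
      show "AE t in M. norm (q r t ^ 2) \<le> B ^ 2"
        using q(2)[of _ r] unfolding real_norm_def power_abs by (intro AE_I2 power_mono) auto
    qed (use q(1) in measurable)
    ultimately have "AE t in M. q r t ^ 2 = 0"
      using integral_nonneg_eq_0_iff_AE[of M "\<lambda>t. q r t ^ 2"] by auto
    then show ?thesis by simp
  qed
  then have "AE t in M. \<forall>r. q r t = 0" by (simp add: AE_all_countable)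
  moreover have "{t \<in> space M. \<forall>r. q r t = 0} \<in> events" using q(1) by measurable
  ultimately show ?thesis by (simp add: prob_Collect_eq_1)
qed

section \<open>Means near the diagonal\<close>

lemma open_cube: "open I \<Longrightarrow> open (cube I :: (real ^ 'd::finite) set)"
  unfolding cube_def using open_vector_box[of "\<lambda>_::'d. I"] by simp

lemma diag_in_cube [simp]: "diag x \<in> cube I \<longleftrightarrow> x \<in> I"
  by (simp add: diag_def cube_def)

text \<open>A mean is squeezed between the smallest and the largest coordinate, so it has Lipschitz constant one
  at the diagonal, uniformly in \<open>t\<close>.\<close>

lemma mean_near_diag:
  fixes v :: "real ^ 'd::finite"
  assumes m: "measurable_family I \<mu> m" and t: "t \<in> space \<mu>"
    and cube: "diag x + v \<in> cube I"
  shows "\<bar>m (diag x + v) t - x\<bar> \<le> norm v"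
proof -
  have mean: "mean_on I (\<lambda>x. m x t)" using m t by (simp add: measurable_family_def)
  have "Min (range (\<lambda>i. (diag x + v) $ i)) \<le> m (diag x + v) t"
    "m (diag x + v) t \<le> Max (range (\<lambda>i. (diag x + v) $ i))"
    using mean cube unfolding mean_on_def by blast+
  moreover have "\<bar>v $ i\<bar> \<le> norm v" for i by (rule component_le_norm_cart)
  then have "x - norm v \<le> Min (range (\<lambda>i. (diag x + v) $ i))"
    "Max (range (\<lambda>i. (diag x + v) $ i)) \<le> x + norm v"
    by (auto simp: Min_ge_iff Max_le_iff diag_def abs_le_iff) (smt (verit))+
  ultimately show ?thesis unfolding abs_le_iff by linarith
qed

lemma directional_derivative_at_diag:
  fixes m :: "real ^ 'd::finite \<Rightarrow> 't \<Rightarrow> real" and v :: "real ^ 'd"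
  assumes I: "open I" "x \<in> I" and m: "m \<in> family_C1 I \<mu>" and t: "t \<in> space \<mu>"
  shows "((\<lambda>s. (m (diag x + s *\<^sub>R v) t - x) / s) \<longlongrightarrow> (\<Sum>r\<in>UNIV. v $ r * pd r m (diag x) t)) (at 0)"
proof -
  have mf: "measurable_family I \<mu> m" and C1: "cont_pdifferentiable 1 (cube I) (\<lambda>x. m x t)"
    using m t by (auto simp: family_C1_def)
  have "m (diag x) t = x" using mean_near_diag[OF mf t, of x 0] I(2) by simp
  moreover have "((\<lambda>s. m (diag x + s *\<^sub>R v) t) has_real_derivative (\<Sum>r\<in>UNIV. v $ r * pd r m (diag x) t)) (at 0)"
    unfolding pd_def using has_real_derivative_directional[OF open_cube[OF I(1)] _ C1] I(2) by simp
  ultimately show ?thesis by (simp add: has_field_derivative_iff)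
qed

text \<open>At the diagonal, the difference quotients of a mean along an axis lie in \<open>[-1, 1]\<close>.\<close>

lemma pd_diag_bounded:
  fixes m :: "real ^ 'd::finite \<Rightarrow> 't \<Rightarrow> real"
  assumes I: "open I" "x \<in> I" and m: "m \<in> family_C1 I \<mu>" and t: "t \<in> space \<mu>"
  shows "\<bar>pd r m (diag x) t\<bar> \<le> 1"
proof -
  have mf: "measurable_family I \<mu> m" using m by (auto simp: family_C1_def)
  have "(\<Sum>r'\<in>UNIV. axis r 1 $ r' * pd r' m (diag x) t) = (\<Sum>r'\<in>UNIV. if r' = r then pd r' m (diag x) t else 0)"
    by (intro sum.cong) (auto simp: axis_def)
  then have lim: "((\<lambda>s. (m (diag x + s *\<^sub>R axis r 1) t - x) / s) \<longlongrightarrow> pd r m (diag x) t) (at 0)"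
    using directional_derivative_at_diag[OF I m t, of "axis r 1"] by simp
  have "isCont (\<lambda>s. diag x + s *\<^sub>R axis r 1 :: real ^ 'd) 0" by (intro continuous_intros)
  then have "((\<lambda>s. diag x + s *\<^sub>R axis r 1 :: real ^ 'd) \<longlongrightarrow> diag x) (at 0)" by (simp add: isCont_def)
  then have "eventually (\<lambda>s. diag x + s *\<^sub>R axis r 1 \<in> (cube I :: (real ^ 'd) set)) (at 0)"
    using I open_cube[OF I(1)] by (auto intro: topological_tendstoD)
  moreover have "eventually (\<lambda>s::real. s \<noteq> 0) (at 0)" by (rule eventually_neq_at_within)
  ultimately have "eventually (\<lambda>s. \<bar>(m (diag x + s *\<^sub>R axis r 1) t - x) / s\<bar> \<le> 1) (at 0)"
  proof eventually_elim
    case (elim s)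
    from mean_near_diag[OF mf t elim(1)] elim(2) show ?case
      by (simp add: norm_axis_1)
  qed
  then show ?thesis by (intro tendsto_upperbound[OF tendsto_rabs[OF lim]]) auto
qed

lemma pd_diag_integrable:
  fixes m :: "real ^ 'd::finite \<Rightarrow> 't \<Rightarrow> real"
  assumes I: "open I" "x \<in> I" and \<mu>: "prob_space \<mu>" and m: "m \<in> family_C1 I \<mu>"
  shows "integrable \<mu> (pd r m (diag x))"
proof -
  interpret prob_space \<mu> by (rule \<mu>)
  have "L_type 1 I \<mu> (pd r m) (diag x)" using m I(2) by (simp add: family_C1_def)
  then show ?thesis
    using pd_diag_bounded[OF I m] by (intro integrable_const_bound[where B = 1]) (auto simp: L_type_def)
qed

lemma pd_star_diag_bounded:
  fixes m :: "real ^ 'd::finite \<Rightarrow> 't \<Rightarrow> real"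
  assumes I: "open I" "x \<in> I" and \<mu>: "prob_space \<mu>" and m: "m \<in> family_C1 I \<mu>" and t: "t \<in> space \<mu>"
  shows "\<bar>pd_star \<mu> r m (diag x) t\<bar> \<le> 2"
proof -
  interpret prob_space \<mu> by (rule \<mu>)
  note pd = pd_diag_bounded[OF I m]
  have int: "integrable \<mu> (pd r m (diag x))" by (rule pd_diag_integrable[OF I \<mu> m])
  have "\<bar>avg \<mu> (pd r m) (diag x)\<bar> \<le> (\<integral>t. \<bar>pd r m (diag x) t\<bar> \<partial>\<mu>)"
    unfolding avg_def by (rule integral_abs_bound)
  also have "\<dots> \<le> 1"
    using int pd by (intro integral_le_const AE_I2) auto
  finally show ?thesis using pd[OF t, of r] unfolding pd_star_def by linarith
qed

section \<open>Comparison of the kernels of two pairs\<close>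

text \<open>At \<open>j = 0\<close> this is \<open>W(h,l)(y) * DD f g u y - W(f,g)(y) * DD h l u y\<close>, and \<open>j\<close> counts derivatives with respect to \<open>u\<close>. It is
  the difference of the kernels \<open>DD f g u y / W(f,g)(y)\<close> and \<open>DD h l u y / W(h,l)(y)\<close> with the denominators cleared.
  Both quotients are \<open>u - y\<close> to first order, so that the linear term cancels.\<close>

definition kernel_gap ::
    "(real \<Rightarrow> real) \<Rightarrow> (real \<Rightarrow> real) \<Rightarrow> (real \<Rightarrow> real) \<Rightarrow> (real \<Rightarrow> real) \<Rightarrow> nat \<Rightarrow> real \<Rightarrow> real \<Rightarrow> real" where
  "kernel_gap f g h l j u y =
     ((deriv ^^ j) f u * g y - (deriv ^^ j) g u * f y) * wronskian h l y
     - ((deriv ^^ j) h u * l y - (deriv ^^ j) l u * h y) * wronskian f g y"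

text \<open>The diagonal is approached along \<open>diag x + s n *\<^sub>R v\<close>. There the common generalized mean \<open>y n\<close> is a zero of
  the integrals of both kernels, hence of the gap. The gap starts with order \<open>n\<close> at the diagonal, and only the first
  derivative of \<open>m\<close> enters into its leading term.\<close>

lemma equal_means_imp_moment_vanishes:
  fixes m :: "real ^ 'd::finite \<Rightarrow> 't \<Rightarrow> real" and v :: "real ^ 'd"
  assumes I: "open I" "is_interval I" "x \<in> I" and \<mu>: "prob_space \<mu>" and n: "0 < n"
    and fg: "(f, g) \<in> chebyshev_class n I" and hl: "(h, l) \<in> chebyshev_class n I"
    and m: "m \<in> family_C1 I \<mu>"
    and U: "open U" "U \<subseteq> cube I" "diag x \<in> U"
      "\<And>z. z \<in> U \<Longrightarrow> gen_mean I f g m \<mu> z = gen_mean I h l m \<mu> z"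
    and diagonal: "\<And>j y. j < n \<Longrightarrow> y \<in> I \<Longrightarrow> kernel_gap f g h l j y y = 0"
  shows "kernel_gap f g h l n x x * (\<integral>t. (\<Sum>r\<in>UNIV. v $ r * pd_star \<mu> r m (diag x) t) ^ n \<partial>\<mu>) = 0"
proof -
  interpret prob_space \<mu> by (rule \<mu>)
  note fgD = chebyshev_classD[OF fg] and hlD = chebyshev_classD[OF hl]
  have mf: "measurable_family I \<mu> m" using m by (auto simp: family_C1_def)
  define C where "C = norm v"
  obtain e where e: "e > 0" "\<And>z. dist z (diag x) < e \<Longrightarrow> z \<in> U"
    using U(1,3) unfolding open_dist by blast
  obtain r0 where r0: "r0 > 0" "cball x r0 \<subseteq> I" using I open_contains_cball by blast
  \<comment> \<open>The step sizes keep all points within \<open>U\<close> and all their coordinates within \<open>cball x r0\<close>; the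
    summand \<open>1\<close> covers \<open>v = 0\<close>.\<close>
  define r where "r = min e r0 / (C + 1)"
  have C: "C + 1 > 0" "C \<ge> 0" by (simp_all add: C_def add_nonneg_pos)
  have "r > 0" using e r0 C by (simp add: r_def)
  define s where "s n = r * inverse (real (Suc n))" for n
  have s: "\<And>n. s n > 0" using \<open>r > 0\<close> by (simp add: s_def)
  have s_lim: "s \<longlonglongrightarrow> 0"
    unfolding s_def using tendsto_mult_right_zero[OF LIMSEQ_inverse_real_of_nat] by simp
  have sC: "s n * C < min e r0" for n
  proof -
    have "s n \<le> r * 1"
      unfolding s_def using \<open>r > 0\<close> by (intro mult_left_mono) (auto simp: field_simps)
    then have "s n * C \<le> r * C" using C by (intro mult_right_mono) auto
    also have "\<dots> < r * (C + 1)" using \<open>r > 0\<close> by simp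
    also have "\<dots> = min e r0" using C by (simp add: r_def)
    finally show ?thesis .
  qed
  define X where "X n = diag x + s n *\<^sub>R v" for n
  have normX: "norm (s n *\<^sub>R v) = s n * C" for n using s[of n] by (simp add: C_def)
  have XU: "X n \<in> U" for n
    using sC[of n] normX[of n] by (intro e(2)) (simp add: X_def dist_norm)
  then have Xcube: "X n \<in> cube I" for n using U(2) by blast
  have box: "X n $ i \<in> {x - s n * C .. x + s n * C}" for n i
    using component_le_norm_cart[of "s n *\<^sub>R v" i] unfolding normX
    by (simp add: X_def diag_def abs_le_iff)
  have sub: "{x - s n * C .. x + s n * C} \<subseteq> I" for n
  proof -
    have "{x - s n * C .. x + s n * C} \<subseteq> cball x r0"
      using sC[of n] by (auto simp: dist_real_def abs_le_iff)
    then show ?thesis using r0(2) by blast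
  qed
  define y where "y n = gen_mean I f g m \<mu> (X n)" for n
  have y': "y n = gen_mean I h l m \<mu> (X n)" for n
    unfolding y_def using U(4)[OF XU] .
  note sol_fg = gen_mean_solves[OF I(1,2) \<mu> fgD(3) mf Xcube box sub, folded y_def]
  note sol_hl = gen_mean_solves[OF I(1,2) \<mu> hlD(3) mf Xcube box sub, folded y']
  have meas: "m (X n) \<in> borel_measurable \<mu>" for n
    using mf Xcube by (simp add: measurable_family_def)
  have int: "integrable \<mu> (\<lambda>t. \<phi> (m (X n) t))" if "continuous_on I \<phi>" for \<phi> :: "real \<Rightarrow> real" and n
    by (rule integrable_continuous_image[OF meas[of n] _ continuous_on_subset[OF that sub[of n]]]) (rule sol_fg(3))
  have cont: "continuous_on I f" "continuous_on I g" "continuous_on I h" "continuous_on I l"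
    using fgD(3) hlD(3) by (simp_all add: chebyshev_system_def)
  note ints = int[OF cont(1)] int[OF cont(2)] int[OF cont(3)] int[OF cont(4)]
  have int_fg: "integrable \<mu> (\<lambda>t. DD f g (m (X n) t) z)"
    and int_hl: "integrable \<mu> (\<lambda>t. DD h l (m (X n) t) z)" for n z
    using ints by (simp_all add: DD_def)
  have gap0: "kernel_gap f g h l 0 u z = DD f g u z * wronskian h l z - DD h l u z * wronskian f g z" for u z
    by (simp add: kernel_gap_def DD_def algebra_simps)
  have isC: "isCont f x" "isCont g x" "isCont h x" "isCont l x"
    using cont I(1,3) by (simp_all add: continuous_on_eq_continuous_at)
  have isC': "isCont (deriv f) x" "isCont (deriv g) x" "isCont (deriv h) x" "isCont (deriv l) x"
    using cont_differentiable_isCont[of n I _ 1 x] fgD hlD I n by (simp_all add: Suc_leI)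
  have isW: "isCont (wronskian f g) x" "isCont (wronskian h l) x"
    unfolding wronskian_def[abs_def] using isC isC' by (auto intro!: continuous_intros)
  define d where "d t = (\<Sum>r\<in>UNIV. v $ r * pd r m (diag x) t)" for t
  have pd_int: "integrable \<mu> (pd r m (diag x))" for r
    by (rule pd_diag_integrable[OF I(1,3) \<mu> m])
  have d_star: "d t - (\<integral>t. d t \<partial>\<mu>) = (\<Sum>r\<in>UNIV. v $ r * pd_star \<mu> r m (diag x) t)" for t
    using pd_int by (simp add: d_def pd_star_def avg_def right_diff_distrib sum_subtractf)
  have "kernel_gap f g h l n x x / fact n * (\<integral>t. (d t - (\<integral>t. d t \<partial>\<mu>)) ^ n \<partial>\<mu>) = 0"
  proof (rule central_moment_vanishes[where E = "DD f g" and W = "wronskian f g x"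
        and G = "kernel_gap f g h l 0" and s = s and p = "\<lambda>n. m (X n)" and y = y and C = C])
    fix \<epsilon> :: real assume \<epsilon>: "\<epsilon> > 0"
    have F1: "cont_differentiable 1 I f" "cont_differentiable 1 I g"
      using fgD I(1) n by (auto intro: cont_differentiable_mono)
    show "\<exists>\<delta>>0. \<forall>u y. \<bar>u - x\<bar> \<le> \<delta> \<longrightarrow> \<bar>y - x\<bar> \<le> \<delta> \<longrightarrow>
        \<bar>DD f g u y - wronskian f g x * (u - y) ^ 1\<bar> \<le> \<epsilon> * \<bar>u - y\<bar> ^ 1"
      using pair_combination_expansion[OF I(1,3) zero_less_one F1 F1, of g "\<lambda>y. - f y" "\<lambda>_. 0" "\<lambda>_. 0" \<epsilon>] isC \<epsilon>
      by (simp add: DD_def wronskian_def algebra_simps)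
    have "\<exists>\<delta>>0. \<forall>u y. \<bar>u - x\<bar> \<le> \<delta> \<longrightarrow> \<bar>y - x\<bar> \<le> \<delta> \<longrightarrow>
        \<bar>kernel_gap f g h l 0 u y - kernel_gap f g h l n x x / fact n * (u - y) ^ n\<bar> \<le> \<epsilon> * \<bar>u - y\<bar> ^ n"
    proof -
      have gap: "kernel_gap f g h l j u y = (deriv ^^ j) f u * (g y * wronskian h l y) + (deriv ^^ j) g u * (- f y * wronskian h l y)
         + (deriv ^^ j) h u * (- l y * wronskian f g y) + (deriv ^^ j) l u * (h y * wronskian f g y)" for j u y
        by (simp add: kernel_gap_def algebra_simps)
      show ?thesis
        unfolding gap
        by (rule pair_combination_expansion[OF I(1,3) n fgD(1,2) hlD(1,2) _ _ _ _ diagonal[unfolded gap] \<epsilon>])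
           (use isC isW in \<open>auto intro!: continuous_intros\<close>)
    qed
    then show "\<exists>\<delta>>0. \<forall>u y. \<bar>u - x\<bar> \<le> \<delta> \<longrightarrow> \<bar>y - x\<bar> \<le> \<delta> \<longrightarrow>
        \<bar>kernel_gap f g h l 0 u y - kernel_gap f g h l n x x / fact n * (u - y) ^ n\<bar> \<le> \<epsilon> * \<bar>u - y\<bar> ^ n" .
  next
    show "wronskian f g x \<noteq> 0" using fgD(4) I(3) .
    show "\<bar>m (X n) t - x\<bar> \<le> s n * C" if "t \<in> space \<mu>" for n t
      using sol_fg(3)[OF that, of n] by (simp add: abs_le_iff)
    show "\<bar>y n - x\<bar> \<le> s n * C" for n
      using sol_fg(1)[of n] by (simp add: abs_le_iff)
    show "integrable \<mu> (\<lambda>t. DD f g (m (X n) t) (y n))" for n by (rule int_fg)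
    show "(\<integral>t. DD f g (m (X n) t) (y n) \<partial>\<mu>) = 0" for n by (rule sol_fg(2))
    show "integrable \<mu> (\<lambda>t. kernel_gap f g h l 0 (m (X n) t) (y n))" for n
      unfolding gap0 using int_fg int_hl by simp
    show "(\<integral>t. kernel_gap f g h l 0 (m (X n) t) (y n) \<partial>\<mu>) = 0" for n
      unfolding gap0 using int_fg int_hl sol_fg(2)[of n] sol_hl(2)[of n] by simp
    show "d \<in> borel_measurable \<mu>"
      unfolding d_def using borel_measurable_integrable[OF pd_int] by measurable
    show "(\<lambda>n. (m (X n) t - x) / s n) \<longlonglongrightarrow> d t" if t: "t \<in> space \<mu>" for t
    proof -
      have "filterlim s (at 0) sequentially"
        using s_lim s by (auto simp: filterlim_at intro!: always_eventually less_imp_neq[symmetric])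
      from filterlim_compose[OF directional_derivative_at_diag[OF I(1,3) m t] this]
      show ?thesis unfolding X_def d_def .
    qed
  qed (use s s_lim meas in auto)
  then show ?thesis by (simp add: d_star)
qed

text \<open>With \<open>f'' g - f g'' = \<Phi> W\<close> the gap of order two compares the functions \<open>\<Phi>\<close>.\<close>

lemma kernel_gap_diag:
  shows "kernel_gap f g h l 0 y y = 0" "kernel_gap f g h l 1 y y = 0"
    and "wronskian f g y \<noteq> 0 \<Longrightarrow> wronskian h l y \<noteq> 0 \<Longrightarrow>
      kernel_gap f g h l 2 y y = wronskian f g y * wronskian h l y * (Phi f g y - Phi h l y)"
proof -
  show "kernel_gap f g h l 0 y y = 0" by (simp add: kernel_gap_def)
  show "kernel_gap f g h l 1 y y = 0" by (simp add: kernel_gap_def wronskian_def algebra_simps)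
  assume W: "wronskian f g y \<noteq> 0" "wronskian h l y \<noteq> 0"
  have "deriv (deriv f) y * g y - f y * deriv (deriv g) y = Phi f g y * wronskian f g y"
    "deriv (deriv h) y * l y - h y * deriv (deriv l) y = Phi h l y * wronskian h l y"
    using W by (simp_all add: Phi_def)
  then have "kernel_gap f g h l 2 y y = Phi f g y * wronskian f g y * wronskian h l y
      - Phi h l y * wronskian h l y * wronskian f g y"
    by (simp add: kernel_gap_def numeral_2_eq_2 mult.commute)
  then show "kernel_gap f g h l 2 y y = wronskian f g y * wronskian h l y * (Phi f g y - Phi h l y)"
    by (simp add: algebra_simps)
qed

text \<open>Put \<open>V = f'' g - f g'' = \<Phi> W = W'\<close>, so that \<open>V' = f''' g - f g''' - \<Psi> W\<close>. Since the functions \<open>\<Phi>\<close> agree on the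
  whole interval, the combination \<open>R\<close> of the functions \<open>V\<close> vanishes identically. In \<open>R' = 0\<close> the
  products \<open>V(f,g) V(h,l)\<close> cancel, and what remains relates the gap of order three to the difference of the
  functions \<open>\<Psi>\<close>.\<close>

lemma kernel_gap_3_diag:
  assumes I: "open I" and n: "2 < n"
    and fg: "(f, g) \<in> chebyshev_class n I" and hl: "(h, l) \<in> chebyshev_class n I"
    and Phi: "\<And>x. x \<in> I \<Longrightarrow> Phi f g x = Phi h l x" and x: "x \<in> I"
  shows "kernel_gap f g h l 3 x x = wronskian f g x * wronskian h l x * (Psi f g x - Psi h l x)"
proof -
  note fgD = chebyshev_classD[OF fg] and hlD = chebyshev_classD[OF hl]
  define V where "V f g x = deriv (deriv f) x * g x - f x * deriv (deriv g) x" for f g :: "real \<Rightarrow> real" and x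
  have W': "(wronskian u v has_real_derivative V u v x) (at x)"
    if "(u, v) \<in> chebyshev_class n I" for u v
    unfolding V_def using chebyshev_classD[OF that] x n by (intro wronskian_has_real_derivative) auto
  have V': "(V u v has_real_derivative (deriv (deriv (deriv u)) x * v x - u x * deriv (deriv (deriv v)) x
       - Psi u v x * wronskian u v x)) (at x)"
    if uv: "(u, v) \<in> chebyshev_class n I" for u v
  proof -
    note D = chebyshev_classD[OF uv]
    note [derivative_intros] =
      cont_differentiable_derivs[OF D(1) x] cont_differentiable_derivs[OF D(2) x]
    have "Psi u v x * wronskian u v x = - (deriv (deriv u) x * deriv v x - deriv u x * deriv (deriv v) x)"
      using D(4)[OF x] by (simp add: Psi_def)
    then show ?thesis
      unfolding V_def[abs_def] using n
      by (auto intro!: derivative_eq_intros simp: algebra_simps)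
  qed
  have V_Phi: "V u v z = Phi u v z * wronskian u v z"
    if "(u, v) \<in> chebyshev_class n I" "z \<in> I" for u v z
    using chebyshev_classD(4)[OF that] by (simp add: V_def Phi_def)
  define R where "R z = V f g z * wronskian h l z - V h l z * wronskian f g z" for z
  let ?f3 = "deriv (deriv (deriv f)) x" and ?g3 = "deriv (deriv (deriv g)) x"
    and ?h3 = "deriv (deriv (deriv h)) x" and ?l3 = "deriv (deriv (deriv l)) x"
  have "(R has_real_derivative
      (?f3 * g x - f x * ?g3 - Psi f g x * wronskian f g x) * wronskian h l x + V h l x * V f g x
      - ((?h3 * l x - h x * ?l3 - Psi h l x * wronskian h l x) * wronskian f g x + V f g x * V h l x)) (at x)"
    unfolding R_def[abs_def]
    by (intro DERIV_diff DERIV_mult V' W' fg hl)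
  moreover have "(R has_real_derivative 0) (at x)"
  proof (rule has_field_derivative_transform_within_open[OF DERIV_const I x])
    show "0 = R z" if "z \<in> I" for z
      using that by (simp add: R_def V_Phi fg hl Phi)
  qed
  ultimately have "(?f3 * g x - f x * ?g3 - Psi f g x * wronskian f g x) * wronskian h l x + V h l x * V f g x
      - ((?h3 * l x - h x * ?l3 - Psi h l x * wronskian h l x) * wronskian f g x + V f g x * V h l x) = 0"
    by (rule DERIV_unique)
  moreover have "kernel_gap f g h l 3 x x =
      (?f3 * g x - f x * ?g3) * wronskian h l x - (?h3 * l x - h x * ?l3) * wronskian f g x"
    by (simp add: kernel_gap_def numeral_3_eq_3 mult.commute)
  ultimately show ?thesis by (simp add: algebra_simps)
qed

section \<open>Equality of generalized means\<close>

lemma eq_on_dense_subset: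
  fixes F G :: "real \<Rightarrow> real"
  assumes "continuous_on I F" "continuous_on I G" "D \<subseteq> I" "I \<subseteq> closure D"
    and "\<And>x. x \<in> D \<Longrightarrow> F x = G x" "x \<in> I"
  shows "F x = G x"
proof -
  obtain X where X: "\<And>n. X n \<in> D" "X \<longlonglongrightarrow> x"
    using assms(4,6) closure_sequential[of x D] by blast
  then have XI: "\<And>n. X n \<in> I" using assms(3) by blast
  have "(\<lambda>n. F (X n)) \<longlonglongrightarrow> F x" "(\<lambda>n. G (X n)) \<longlonglongrightarrow> G x"
    using assms(1,2,6) X(2) XI
    by (auto intro!: continuous_on_tendsto_compose[where f = F] continuous_on_tendsto_compose[where f = G])
  moreover have "(\<lambda>n. F (X n)) = (\<lambda>n. G (X n))" using X(1) assms(5) by simp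
  ultimately show ?thesis using LIMSEQ_unique by metis
qed

lemma continuous_on_Phi_Psi:
  assumes I: "open I" and n: "1 < n" and fg: "(f, g) \<in> chebyshev_class n I"
  shows "continuous_on I (Phi f g)" "continuous_on I (Psi f g)"
proof -
  note fgD = chebyshev_classD[OF fg]
  have *: "continuous_on I ((deriv ^^ j) u)" if "j \<le> 2" "cont_differentiable n I u" for j u
    using cont_differentiable_isCont[OF that(2) _ _ I, of j] that(1) n
    by (intro continuous_at_imp_continuous_on) auto
  have c: "continuous_on I u" "continuous_on I (deriv u)" "continuous_on I (deriv (deriv u))"
    if "cont_differentiable n I u" for u
    using *[of 0 u] *[of 1 u] *[of 2 u] that by (simp_all add: numeral_2_eq_2)
  have W: "continuous_on I (wronskian f g)"
    unfolding wronskian_def[abs_def] by (intro continuous_intros c fgD)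
  show "continuous_on I (Phi f g)"
    unfolding Phi_def[abs_def] using fgD(4) by (intro continuous_intros W c fgD(1,2)) auto
  show "continuous_on I (Psi f g)"
    unfolding Psi_def[abs_def] using fgD(4) by (intro continuous_intros W c fgD(1,2)) auto
qed

theorem theorem3p1:
  fixes I D :: "real set" and \<mu> :: "'t measure"
    and f g h k :: "real \<Rightarrow> real"
    and m :: "real ^ 'd::finite \<Rightarrow> 't \<Rightarrow> real"
  assumes I: "open I" "is_interval I" "I \<noteq> {}"
    and \<mu>: "prob_space \<mu>"
    and fg: "(f, g) \<in> chebyshev_class 3 I"
    and hk: "(h, k) \<in> chebyshev_class 3 I"
    and m: "m \<in> family_C3 I \<mu>"
    and D: "D \<subseteq> I" "I \<subseteq> closure D"
    and nondegenerate: "\<And>x. x \<in> D \<Longrightarrow>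
      measure \<mu> {t \<in> space \<mu>. \<forall>r. pd_star \<mu> r m (diag x) t = 0} < 1"
    and third_moment: "\<And>x. x \<in> D \<Longrightarrow>
      \<exists>i j l. avg \<mu> (\<lambda>y t. pd_star \<mu> i m y t * pd_star \<mu> j m y t * pd_star \<mu> l m y t) (diag x) \<noteq> 0"
  shows "((\<forall>x\<in>cube I. gen_mean I f g m \<mu> x = gen_mean I h k m \<mu> x)
      \<longleftrightarrow> (\<exists>U. open U \<and> U \<subseteq> cube I \<and> diag ` D \<subseteq> U \<and>
            (\<forall>x\<in>U. gen_mean I f g m \<mu> x = gen_mean I h k m \<mu> x)))
    \<and> ((\<exists>U. open U \<and> U \<subseteq> cube I \<and> diag ` D \<subseteq> U \<and>
            (\<forall>x\<in>U. gen_mean I f g m \<mu> x = gen_mean I h k m \<mu> x))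
      \<longleftrightarrow> (\<forall>x\<in>I. Phi f g x = Phi h k x \<and> Psi f g x = Psi h k x))
    \<and> ((\<forall>x\<in>I. Phi f g x = Phi h k x \<and> Psi f g x = Psi h k x)
      \<longleftrightarrow> equivalent_pairs I (f, g) (h, k))"
    (is "(?i \<longleftrightarrow> ?ii) \<and> (?ii \<longleftrightarrow> ?iii) \<and> (?iii \<longleftrightarrow> ?iv)")
proof -
  interpret prob_space \<mu> by (rule \<mu>)
  have m1: "m \<in> family_C1 I \<mu>" using m by (simp add: family_C3_def family_C2_def)
  then have mf: "measurable_family I \<mu> m" by (simp add: family_C1_def)
  note fgD = chebyshev_classD[OF fg] and hkD = chebyshev_classD[OF hk]
  have fg2: "(f, g) \<in> chebyshev_class 2 I" and hk2: "(h, k) \<in> chebyshev_class 2 I"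
    using fgD hkD I(1) by (auto simp: chebyshev_class_def intro: cont_differentiable_mono[where n = 3])
  have "?i \<Longrightarrow> ?ii"
    using open_cube[OF I(1), where 'd = 'd] D(1) by (intro exI[of _ "cube I"]) auto
  moreover have "?iv \<Longrightarrow> ?i"
    using equivalent_pairs_imp_gen_mean_eq[OF mf] by blast
  moreover have "?iii \<Longrightarrow> ?iv"
    using Phi_Psi_eq_imp_equivalent_pairs[OF I(2,3) _ fg2 hk2] by simp
  moreover have "?iv \<Longrightarrow> ?iii"
    using equivalent_pairs_imp_Phi_Psi_eq[OF I(1) _ hk2] by simp
  moreover have ?iii if ii: ?ii
  proof -
    obtain U where U: "open U" "U \<subseteq> cube I" "diag ` D \<subseteq> U"
      "\<And>z. z \<in> U \<Longrightarrow> gen_mean I f g m \<mu> z = gen_mean I h k m \<mu> z"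
      using ii by blast
    have dU: "diag x \<in> U" if "x \<in> D" for x using U(3) that by blast
    have star: "pd_star \<mu> r m (diag x) \<in> borel_measurable \<mu>"
      "\<And>t. t \<in> space \<mu> \<Longrightarrow> \<bar>pd_star \<mu> r m (diag x) t\<bar> \<le> 2" if "x \<in> I" for r x
      using pd_diag_integrable[OF I(1) that \<mu> m1, of r] pd_star_diag_bounded[OF I(1) that \<mu> m1]
      by (simp_all add: pd_star_def[abs_def])
    note moment = equal_means_imp_moment_vanishes[OF I(1,2) _ \<mu> _ _ _ m1 U(1,2) dU U(4)]
    \<comment> \<open>Second moments first: \<open>Phi\<close> must agree on all of \<open>I\<close>, not only on \<open>D\<close>, before the
      third-order term can be compared.\<close>
    have Phi_D: "Phi f g x = Phi h k x" if x: "x \<in> D" for x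
    proof (rule ccontr)
      assume ne: "Phi f g x \<noteq> Phi h k x"
      have xI: "x \<in> I" using x D(1) by blast
      have "kernel_gap f g h k 2 x x \<noteq> 0"
        using ne fgD(4)[OF xI] hkD(4)[OF xI] by (simp add: kernel_gap_diag)
      moreover have "kernel_gap f g h k j y y = 0" if "j < 2" for j y
        using that kernel_gap_diag(1,2) by (auto simp: less_2_cases_iff)
      ultimately have "(\<integral>t. (\<Sum>r\<in>UNIV. v $ r * pd_star \<mu> r m (diag x) t) ^ 2 \<partial>\<mu>) = 0" for v
        using moment[OF xI _ fg2 hk2 x, of v] by simp
      from quadratic_moments_determine_zero[OF star[OF xI] this] nondegenerate[OF x]
      show False by simp
    qed
    have Phi: "Phi f g x = Phi h k x" if "x \<in> I" for x
      using continuous_on_Phi_Psi(1)[OF I(1) _ fg] continuous_on_Phi_Psi(1)[OF I(1) _ hk]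
      by (intro eq_on_dense_subset[OF _ _ D Phi_D that]) auto
    have Psi_D: "Psi f g x = Psi h k x" if x: "x \<in> D" for x
    proof (rule ccontr)
      assume ne: "Psi f g x \<noteq> Psi h k x"
      have xI: "x \<in> I" using x D(1) by blast
      have "kernel_gap f g h k 3 x x \<noteq> 0"
        using ne fgD(4)[OF xI] hkD(4)[OF xI] kernel_gap_3_diag[OF I(1) _ fg hk Phi xI] by simp
      moreover have "kernel_gap f g h k j y y = 0" if "j < 3" "y \<in> I" for j y
      proof -
        have "j = 0 \<or> j = 1 \<or> j = 2" using that(1) by linarith
        then show ?thesis
          using kernel_gap_diag[where y = y] fgD(4) hkD(4) Phi that(2) by auto
      qed
      ultimately have "(\<integral>t. (\<Sum>r\<in>UNIV. v $ r * pd_star \<mu> r m (diag x) t) ^ 3 \<partial>\<mu>) = 0" for v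
        using moment[OF xI _ fg hk x, of v] by simp
      from cubic_moments_determine_trilinear[OF star[OF xI] this] third_moment[OF x]
      show False by (simp add: avg_def)
    qed
    have "Psi f g x = Psi h k x" if "x \<in> I" for x
      using continuous_on_Phi_Psi(2)[OF I(1) _ fg] continuous_on_Phi_Psi(2)[OF I(1) _ hk]
      by (intro eq_on_dense_subset[OF _ _ D Psi_D that]) auto
    with Phi show ?thesis by blast
  qed
  ultimately show ?thesis by blast
qed

end
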